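(* Assume $\kappa^{<\kappa}=\kappa\ge\aleph_1$ and let $W\subseteq\kappa$ be stationary in $\kappa$. Suppose there are a cardinal $\sigma<\kappa$ and a set $S\subseteq\kappa$ such that (a) $\kappa=\kappa^{<\kappa}=2^\sigma$, (b) $2^{<\sigma}<\kappa$, and (c) $S\subseteq\{\alpha<\kappa:\operatorname{cf}(\alpha)=\operatorname{cf}(\sigma)\}$, $S$ is stationary in $\kappa$, and $S\in\check I[\kappa]$. Then $\mathbb{Q}^{\rm Sacks}_{(\kappa,W)}\Vdash\diamondsuit_\kappa(S)$.
   Context: Diamond: for a cardinal $\kappa$ of uncountable cofinality and stationary $S\subseteq\kappa$, $\diamondsuit_\kappa(S)$ says: there is a sequence $\langle d_\delta:\delta\in S\rangle$ with $d_\delta\in{}^\delta 2$ such that for every $x\in{}^\kappa2$ the set $\{\delta\in S: d_\delta=x\restriction\delta\}$ is stationary in $\kappa$. Approachability ideal $\check I[\kappa]$: for a sequence $\bar a=\langle a_\alpha:\alpha<\kappa\rangle$ of elements of $[\kappa]^{<\kappa}$, $\check I[\kappa](\bar a)$ is the set of all $S\subseteq\kappa$ for which there is a club $C\subseteq\kappa$ such that for every $\delta\in S\cap C$ there is a club $C_\delta\subseteq\delta$, cofinal in $\delta$, of order type $\operatorname{cf}(\delta)$, with $\{C_\delta\cap\beta:\beta<\delta\}\subseteq\{a_\alpha:\alpha<\delta\}$. $\check I[\kappa]$ is the union of all $\check I[\kappa](\bar a)$ over such sequences $\bar a$. Forcing convention: $p\le q$ means $q$ is stronger than $p$; $\mathbb{P}\Vdash\varphi$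 means that every condition of $\mathbb{P}$ forces $\varphi$. Trees: ${}^{\kappa>}2$ is the set of functions $t:\alpha\to2$ with $\alpha<\kappa$; $\trianglelefteq$ is the initial segment relation and $\triangleleft$ its strict version. A tree is a non-empty subset of ${}^{\kappa>}2$ closed under initial segments. $\operatorname{split}(p)$ is the set of nodes of $p$ having at least two immediate successors in $p$. $\mathbb{Q}^{\rm Sacks}_{(\kappa,W)}$ (for regular uncountable $\kappa$ and stationary $W\subseteq\kappa$): conditions are $p$ such that (a) $p$ is a non-empty subtree of ${}^{\kappa>}2$; (b) $p$ is closed under unions of $\triangleleft$-increasing sequences of length $<\kappa$; (c) for every $\eta\in p$ there is $\nu\in p$ with $\eta\trianglelefteq\nu$ and $\nu^\frown\langle0\rangle,\nu^\frown\langle1\rangle\in p$; (d) if $\delta<\kappa$ is a limit ordinal and $\langle\eta_\varepsilon:\varepsilon<\delta\rangle$ is a $\triangleleft$-increasing sequence with every $\eta_\varepsilon\in\operatorname{split}(p)$ and $\sup_{\varepsilon<\delta}\operatorname{dom}(\eta_\varepsilon)\in W$, then $\bigcup_{\varepsilon<\delta}\eta_\varepsilon\in\operatorname{split}(p)$. The order is $p\le q$ iff $p\supseteq q$. *)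

theory Defs
  imports Main
begin

unbundle cardinal_syntax

section \<open>Ordinals below \<open>\<kappa>\<close>\<close>

text \<open>
  The cardinal \<open>\<kappa>\<close> is a type \<open>'a\<close> of class \<^class>\<open>wellorder\<close> whose order is an initial
  ordinal, i.e. \<open>Card_order ord_le\<close> holds. The ordinals below \<open>\<kappa>\<close> are the elements of \<open>'a\<close>, and
  the ordinal \<open>\<alpha>\<close>, as the set of its predecessors, is \<open>{..<\<alpha>}\<close>; \<open>\<kappa>\<close> itself is \<open>UNIV\<close>.
  The notions below that take a parameter \<open>A\<close> are meant for \<open>A = UNIV\<close> and \<open>A = {..<\<delta>}\<close>.
\<close>

definition ord_le :: "'a::wellorder rel" where
  "ord_le = {(x, y). x \<le> y}"

definition is_limit :: "'a::wellorder \<Rightarrow> bool" where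
  "is_limit \<delta> \<longleftrightarrow> (\<exists>\<beta>. \<beta> < \<delta>) \<and> (\<forall>\<beta><\<delta>. \<exists>\<gamma><\<delta>. \<beta> < \<gamma>)"

definition cofinal_in :: "'a::wellorder set \<Rightarrow> 'a set \<Rightarrow> bool" where
  "cofinal_in A C \<longleftrightarrow> C \<subseteq> A \<and> (\<forall>\<alpha>\<in>A. \<exists>\<gamma>\<in>C. \<alpha> \<le> \<gamma>)"

definition closed_in :: "'a::wellorder set \<Rightarrow> 'a set \<Rightarrow> bool" where
  "closed_in A C \<longleftrightarrow>
     (\<forall>\<delta>\<in>A. is_limit \<delta> \<longrightarrow> cofinal_in {..<\<delta>} (C \<inter> {..<\<delta>}) \<longrightarrow> \<delta> \<in> C)"

definition club_in :: "'a::wellorder set \<Rightarrow> 'a set \<Rightarrow> bool" where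
  "club_in A C \<longleftrightarrow> cofinal_in A C \<and> closed_in A C"

definition stationary :: "'a::wellorder set \<Rightarrow> bool" where
  "stationary S \<longleftrightarrow> (\<forall>C. club_in UNIV C \<longrightarrow> S \<inter> C \<noteq> {})"

definition has_otp :: "'a::wellorder set \<Rightarrow> 'a \<Rightarrow> bool" where
  "has_otp C \<beta> \<longleftrightarrow> Restr ord_le C =o Restr ord_le {..<\<beta>}"

definition cf :: "'a::wellorder \<Rightarrow> 'a" where
  "cf \<alpha> = (LEAST \<beta>. \<exists>C. cofinal_in {..<\<alpha>} C \<and> has_otp C \<beta>)"

text \<open>\<open>seqs_below A\<close> is the set of sequences whose length belongs to \<open>A\<close>. So \<open>|seqs_below UNIV|\<close>
  at type \<open>'a \<rightharpoonup> 'a\<close> is \<open>\<kappa>\<^bsup><\<kappa>\<^esup>\<close>, and \<open>|seqs_below {..<\<sigma>}|\<close> at type \<open>'a \<rightharpoonup> bool\<close>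
  is \<open>2\<^bsup><\<sigma>\<^esup>\<close>.\<close>

definition seqs_below :: "'a::wellorder set \<Rightarrow> ('a \<rightharpoonup> 'b) set" where
  "seqs_below A = {t. \<exists>\<alpha>\<in>A. dom t = {..<\<alpha>}}"


section \<open>The approachability ideal\<close>

definition approach_ideal_of :: "('a::wellorder \<Rightarrow> 'a set) \<Rightarrow> 'a set set" where
  "approach_ideal_of a = {S. \<exists>C. club_in UNIV C \<and>
     (\<forall>\<delta>\<in>S \<inter> C. \<exists>D. club_in {..<\<delta>} D \<and> has_otp D (cf \<delta>) \<and>
        {D \<inter> {..<\<beta>} |\<beta>. \<beta> < \<delta>} \<subseteq> {a \<alpha> |\<alpha>. \<alpha> < \<delta>})}"

definition approach_ideal :: "'a::wellorder set set" where
  "approach_ideal = \<Union> {approach_ideal_of a |a. \<forall>\<alpha>. |a \<alpha>| <o (ord_le :: 'a rel)}"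


section \<open>Sacks forcing\<close>

text \<open>Nodes of \<open>\<^bsup>\<kappa>>\<^esup>2\<close> are maps in \<open>seqs_below UNIV\<close>; on these, \<open>\<subseteq>\<^sub>m\<close> is the initial segment
  relation. The union of a family of nodes is taken on graphs.\<close>

type_synonym 'a node = "'a \<rightharpoonup> bool"

definition snoc :: "'a::wellorder node \<Rightarrow> bool \<Rightarrow> 'a node" where
  "snoc \<eta> b = \<eta>((LEAST \<alpha>. \<alpha> \<notin> dom \<eta>) \<mapsto> b)"

definition is_tree :: "'a::wellorder node set \<Rightarrow> bool" where
  "is_tree p \<longleftrightarrow> p \<noteq> {} \<and> p \<subseteq> seqs_below UNIV \<and>
     (\<forall>\<eta>\<in>p. \<forall>\<nu>\<in>seqs_below UNIV. \<nu> \<subseteq>\<^sub>m \<eta> \<longrightarrow> \<nu> \<in> p)"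

definition split :: "'a::wellorder node set \<Rightarrow> 'a node set" where
  "split p = {\<eta>\<in>p. card {\<nu>\<in>p. \<exists>b. \<nu> = snoc \<eta> b} \<ge> 2}"

definition increasing_below :: "'a::wellorder \<Rightarrow> ('a \<Rightarrow> 'a node) \<Rightarrow> bool" where
  "increasing_below \<delta> \<eta> \<longleftrightarrow>
     (\<forall>\<epsilon> \<zeta>. \<epsilon> < \<zeta> \<and> \<zeta> < \<delta> \<longrightarrow> \<eta> \<epsilon> \<subseteq>\<^sub>m \<eta> \<zeta> \<and> \<eta> \<epsilon> \<noteq> \<eta> \<zeta>)"

definition is_union_below :: "'a::wellorder \<Rightarrow> ('a \<Rightarrow> 'a node) \<Rightarrow> 'a node \<Rightarrow> bool" where
  "is_union_below \<delta> \<eta> u \<longleftrightarrow> Map.graph u = (\<Union>\<epsilon><\<delta>. Map.graph (\<eta> \<epsilon>))"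

definition sacks :: "'a::wellorder set \<Rightarrow> 'a node set set" where
  "sacks W = {p. is_tree p \<and>
     (\<forall>\<delta> \<eta>. increasing_below \<delta> \<eta> \<and> (\<forall>\<epsilon><\<delta>. \<eta> \<epsilon> \<in> p) \<longrightarrow>
        (\<exists>u\<in>p. is_union_below \<delta> \<eta> u)) \<and>
     (\<forall>\<eta>\<in>p. \<exists>\<nu>\<in>p. \<eta> \<subseteq>\<^sub>m \<nu> \<and> snoc \<nu> False \<in> p \<and> snoc \<nu> True \<in> p) \<and>
     (\<forall>\<delta> \<eta>. is_limit \<delta> \<and> increasing_below \<delta> \<eta> \<and> (\<forall>\<epsilon><\<delta>. \<eta> \<epsilon> \<in> split p) \<and>
        (\<exists>\<theta>\<in>W. {..<\<theta>} = (\<Union>\<epsilon><\<delta>. dom (\<eta> \<epsilon>))) \<longrightarrow>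
        (\<exists>u\<in>split p. is_union_below \<delta> \<eta> u))}"

definition sacks_le :: "'a node set \<Rightarrow> 'a node set \<Rightarrow> bool" where
  "sacks_le p q \<longleftrightarrow> q \<subseteq> p"


section \<open>The forcing relation\<close>

text \<open>
  A statement of the forcing language is represented by the predicate on conditions \<open>p\<close> saying that
  \<open>p\<close> forces it; the operations below are the usual recursion clauses of the forcing relation, and
  \<open>le p q\<close> means that \<open>q\<close> is stronger than \<open>p\<close>.

  A name for a subset of a ground model set \<open>B\<close> is a set of pairs \<open>(b, s)\<close>, with \<open>s\<close> a condition,
  standing for the name consisting of the pairs of the check name of \<open>b\<close> and \<open>s\<close>. Every subset of \<open>B\<close>
  in the generic extension has a name of this form. A function \<open>B \<rightarrow> 2\<close> of the extension is
  identified with the set of all \<open>b\<close> where its value is 1.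

  \<open>forces_ball\<close> and \<open>forces_bex\<close> quantify over the elements of (the check name of) a ground model
  set, \<open>forces_all_names\<close> and \<open>forces_ex_name\<close> over all subsets, in the extension, of a ground model
  set.
\<close>

type_synonym 'p statement = "'p \<Rightarrow> bool"
type_synonym ('b, 'p) name = "('b \<times> 'p) set"

locale forcing =
  fixes P :: "'p set" and le :: "'p \<Rightarrow> 'p \<Rightarrow> bool"
begin

definition forces_mem :: "'b \<Rightarrow> ('b, 'p) name \<Rightarrow> 'p statement" where
  "forces_mem b \<tau> p \<longleftrightarrow>
     (\<forall>q\<in>P. le p q \<longrightarrow> (\<exists>r\<in>P. le q r \<and> (\<exists>s\<in>P. (b, s) \<in> \<tau> \<and> le s r)))"

definition forces_not :: "'p statement \<Rightarrow> 'p statement" where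
  "forces_not \<phi> p \<longleftrightarrow> (\<forall>q\<in>P. le p q \<longrightarrow> \<not> \<phi> q)"

definition forces_and :: "'p statement \<Rightarrow> 'p statement \<Rightarrow> 'p statement" where
  "forces_and \<phi> \<psi> p \<longleftrightarrow> \<phi> p \<and> \<psi> p"

definition forces_ball :: "'b set \<Rightarrow> ('b \<Rightarrow> 'p statement) \<Rightarrow> 'p statement" where
  "forces_ball B \<Phi> p \<longleftrightarrow> (\<forall>b\<in>B. \<Phi> b p)"

definition forces_all_names :: "(('b, 'p) name \<Rightarrow> 'p statement) \<Rightarrow> 'p statement" where
  "forces_all_names \<Phi> p \<longleftrightarrow> (\<forall>\<tau>. \<tau> \<subseteq> UNIV \<times> P \<longrightarrow> \<Phi> \<tau> p)"

definition forces_imp :: "'p statement \<Rightarrow> 'p statement \<Rightarrow> 'p statement" where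
  "forces_imp \<phi> \<psi> = forces_not (forces_and \<phi> (forces_not \<psi>))"

definition forces_iff :: "'p statement \<Rightarrow> 'p statement \<Rightarrow> 'p statement" where
  "forces_iff \<phi> \<psi> = forces_and (forces_imp \<phi> \<psi>) (forces_imp \<psi> \<phi>)"

definition forces_bex :: "'b set \<Rightarrow> ('b \<Rightarrow> 'p statement) \<Rightarrow> 'p statement" where
  "forces_bex B \<Phi> = forces_not (forces_ball B (\<lambda>b. forces_not (\<Phi> b)))"

definition forces_ex_name :: "(('b, 'p) name \<Rightarrow> 'p statement) \<Rightarrow> 'p statement" where
  "forces_ex_name \<Phi> = forces_not (forces_all_names (\<lambda>\<tau>. forces_not (\<Phi> \<tau>)))"

definition forced :: "'p statement \<Rightarrow> bool" where
  "forced \<phi> \<longleftrightarrow> (\<forall>p\<in>P. \<phi> p)"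

text \<open>The statements that the set named by \<open>C\<close> is cofinal below \<open>\<delta>\<close>, and that it is a club of \<open>\<kappa>\<close>;
  compare \<^const>\<open>cofinal_in\<close> and \<^const>\<open>club_in\<close>.\<close>

definition forces_cofinal_below :: "'a::wellorder \<Rightarrow> ('a, 'p) name \<Rightarrow> 'p statement" where
  "forces_cofinal_below \<delta> C =
     forces_ball {..<\<delta>} (\<lambda>\<alpha>. forces_bex {\<alpha>..<\<delta>} (\<lambda>\<gamma>. forces_mem \<gamma> C))"

definition forces_club :: "('a::wellorder, 'p) name \<Rightarrow> 'p statement" where
  "forces_club C = forces_and
     (forces_ball UNIV (\<lambda>\<alpha>. forces_bex {\<alpha>..} (\<lambda>\<gamma>. forces_mem \<gamma> C)))
     (forces_ball {\<delta>. is_limit \<delta>}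
        (\<lambda>\<delta>. forces_imp (forces_cofinal_below \<delta> C) (forces_mem \<delta> C)))"

text \<open>The statement that \<open>{\<delta> \<in> S. \<Phi> \<delta>}\<close>, as computed in the extension, is stationary in \<open>\<kappa>\<close>.\<close>

definition forces_stationary :: "'a::wellorder set \<Rightarrow> ('a \<Rightarrow> 'p statement) \<Rightarrow> 'p statement" where
  "forces_stationary S \<Phi> = forces_all_names (\<lambda>C. forces_imp (forces_club C)
     (forces_bex S (\<lambda>\<delta>. forces_and (\<Phi> \<delta>) (forces_mem \<delta> C))))"

text \<open>The sequence \<open>\<langle>d\<^sub>\<delta> : \<delta> \<in> S\<rangle>\<close> with \<open>d\<^sub>\<delta> \<in> \<^bsup>\<delta>\<^esup>2\<close> is coded by one name \<open>d\<close>: the value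
  \<open>d\<^sub>\<delta>(\<epsilon>)\<close> is 1 iff \<open>(\<delta>, \<epsilon>)\<close> belongs to the set named by \<open>d\<close>. Only pairs with \<open>\<delta> \<in> S\<close>
  and \<open>\<epsilon> < \<delta>\<close> matter.\<close>

definition forces_diamond :: "'a::wellorder set \<Rightarrow> 'p statement" where
  "forces_diamond S =
     forces_ex_name (\<lambda>d :: ('a \<times> 'a, 'p) name. forces_all_names (\<lambda>x :: ('a, 'p) name.
       forces_stationary S (\<lambda>\<delta>.
         forces_ball {..<\<delta>} (\<lambda>\<epsilon>. forces_iff (forces_mem (\<delta>, \<epsilon>) d) (forces_mem \<epsilon> x)))))"

end

end

theory Submission
  imports Defs
begin

text \<open>
  Let \<open>\<eta>\<close> be the generic branch in \<open>\<^bsup>\<kappa>\<^esup>2\<close>. The diamond sequence is \<open>d\<^sub>\<delta> = F(\<eta> \<restriction> \<delta>)\<close> for one ground model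
  function \<open>F\<close> from nodes to nodes, which is obtained by diagonalisation.

  Let \<open>x\<close> name a subset of \<open>\<kappa>\<close> and \<open>C\<close> a club. Below any condition one can build a tree of conditions,
  indexed by the binary sequences of length less than \<open>\<sigma>\<close>, in \<open>cf(\<sigma>)\<close> levels: at each level every
  condition is replaced by pairwise incompatible stronger ones, one for each continuation of its index,
  each with a long stem, deciding a long initial segment of \<open>x\<close> and putting a large ordinal into
  \<open>C\<close>. A level has at most \<open>2\<^bsup><\<sigma>\<^esup> < \<kappa>\<close> conditions, so the ordinals that occur there are bounded below
  \<open>\<kappa>\<close>. Decreasing sequences of fewer than \<open>\<kappa>\<close> conditions have their intersection as a lower bound
  (\<open>chain_Inter_sacks\<close>, the place where the stationarity of \<open>W\<close> enters), hence each of the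
  \<open>2\<^sup>\<sigma> = \<kappa>\<close> branches \<open>f\<close> of the tree yields a condition. If the levels are placed along a cofinal
  \<open>D \<subseteq> \<delta>\<close> witnessing that \<open>\<delta> \<in> S\<close> is approachable, every proper initial segment of the construction
  depends only on an initial segment of \<open>D\<close>, which is listed before \<open>\<delta>\<close>; for a closure point \<open>\<delta>\<close> of the
  function bounding the heights, all heights stay below \<open>\<delta>\<close>. So along every branch \<open>f\<close> the limit
  condition decides \<open>\<eta> \<restriction> \<delta> = E(f)\<close> and \<open>x \<restriction> \<delta> = X(f)\<close> and forces \<open>\<delta> \<in> C\<close>, and \<open>E\<close> is injective
  (\<open>guessing_condition\<close>).

  It remains to choose \<open>F\<close> in advance such that \<open>F(E(f)) = X(f)\<close> for some branch \<open>f\<close> of every such tree.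
  The pair \<open>(E, X)\<close> is determined by two functions from \<open>\<^bsup>\<sigma>>\<^esup>2\<close> to \<open>\<^bsup>\<kappa>>\<^esup>2\<close>. As \<open>2\<^bsup><\<sigma>\<^esup> < \<kappa> = \<kappa>\<^bsup><\<kappa>\<^esup>\<close>,
  there are only \<open>\<kappa>\<close> such pairs, while each \<open>E\<close> has \<open>\<kappa>\<close> different values. A recursion of length
  \<open>\<kappa>\<close> therefore picks for each pair a branch whose value under \<open>E\<close> is new, and \<open>F\<close> is defined there
  (\<open>diagonal_guess\<close>, \<open>guessing_function\<close>).
\<close>

section \<open>Regular uncountable cardinals\<close>

abbreviation small :: "'b set \<Rightarrow> 'a itself \<Rightarrow> bool" where
  "small B \<kappa> \<equiv> |B| <o |UNIV :: 'a set|"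

text \<open>
  The assumptions say that \<open>\<kappa>\<close> is an initial ordinal, uncountable, and regular.
\<close>

locale regular_cardinal =
  fixes \<kappa> :: "'a::wellorder itself"
  assumes small_lessThan: "\<And>\<alpha>::'a. small {..<\<alpha>} \<kappa>"
    and small_nat: "small (UNIV :: nat set) \<kappa>"
    and small_bounded: "\<And>B::'a set. small B \<kappa> \<Longrightarrow> \<exists>\<alpha>. \<forall>b\<in>B. b < \<alpha>"
begin

lemma small_image: "small B \<kappa> \<Longrightarrow> small (h ` B) \<kappa>"
  by (meson card_of_image ordLeq_ordLess_trans)

lemma small_finite: "finite B \<Longrightarrow> small B \<kappa>"
proof -
  assume "finite B"
  then have "|B| <o |UNIV :: nat set|"
    by (intro finite_ordLess_infinite[OF card_of_Well_order card_of_Well_order])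
      (simp_all add: Field_card_of)
  then show ?thesis using small_nat by (rule ordLess_transitive)
qed

lemma infinite_ordinals: "infinite (UNIV :: 'a set)"
  using small_nat by (metis card_of_ordLeq_infinite infinite_UNIV_nat ordLess_imp_ordLeq)

lemma image_bounded:
  fixes h :: "'b \<Rightarrow> 'a"
  shows "small B \<kappa> \<Longrightarrow> \<exists>\<alpha>. \<forall>b\<in>B. h b < \<alpha>"
  using small_bounded[OF small_image] by fastforce

lemma ex_greater: "\<exists>\<beta>::'a. \<alpha> < \<beta>"
  using small_bounded[of "{\<alpha>}"] small_finite by blast

definition suc :: "'a \<Rightarrow> 'a" where
  "suc \<alpha> = (LEAST \<beta>. \<alpha> < \<beta>)"

lemma less_suc_iff [simp]: "\<beta> < suc \<alpha> \<longleftrightarrow> \<beta> \<le> \<alpha>"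
  unfolding suc_def
  by (metis LeastI_ex Least_le ex_greater leD le_less_trans not_le_imp_less)

lemma lessThan_suc: "{..<suc \<alpha>} = insert \<alpha> {..<\<alpha>}"
  by (auto simp: order_le_less)

lemma suc_less_limit: "is_limit \<delta> \<Longrightarrow> \<alpha> < \<delta> \<Longrightarrow> suc \<alpha> < \<delta>"
  unfolding is_limit_def by (metis leD less_suc_iff linorder_not_le order_trans)

lemma not_limit_cases:
  assumes "\<not> is_limit (\<delta>::'a)"
  obtains "{..<\<delta>} = {}" | \<alpha> where "\<delta> = suc \<alpha>"
proof -
  have "\<exists>\<alpha>. \<delta> = suc \<alpha>" if "\<beta> < \<delta>" for \<beta>
  proof -
    have "\<exists>\<alpha><\<delta>. \<forall>\<gamma><\<delta>. \<not> \<alpha> < \<gamma>"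
      using assms that unfolding is_limit_def by blast
    then obtain \<alpha> where \<alpha>: "\<alpha> < \<delta>" "\<forall>\<gamma><\<delta>. \<gamma> \<le> \<alpha>"
      using not_less by blast
    then have "\<delta> = suc \<alpha>"
      by (metis less_suc_iff linorder_neqE order.irrefl leD order.refl)
    then show ?thesis by blast
  qed
  then show thesis using that by (metis lessThan_iff equals0I)
qed

text \<open>
  For unboundedness, iterate \<open>\<omega>\<close> times a function that majorises \<open>h\<close> on initial segments; the least strict
  upper bound of the iterates is below \<open>\<kappa>\<close> because \<open>\<kappa>\<close> is regular and uncountable.
\<close>

lemma club_closure_points:
  fixes h :: "'a \<Rightarrow> 'a"
  shows "club_in UNIV {\<delta>. is_limit \<delta> \<and> (\<forall>\<alpha><\<delta>. h \<alpha> < \<delta>)}" (is "club_in _ ?E")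
  unfolding club_in_def
proof
  have "\<exists>\<beta>. \<alpha> < \<beta> \<and> (\<forall>\<gamma>\<le>\<alpha>. h \<gamma> < \<beta>)" for \<alpha>
  proof -
    obtain \<beta> where "\<forall>\<gamma>\<in>{..<suc \<alpha>}. h \<gamma> < \<beta>"
      using image_bounded[OF small_lessThan] by blast
    moreover obtain \<beta>' where "\<alpha> < \<beta>'" using ex_greater by blast
    ultimately show ?thesis
      by (intro exI[of _ "max \<beta> \<beta>'"]) (auto simp: less_max_iff_disj)
  qed
  then obtain s where s: "\<And>\<alpha>. \<alpha> < s \<alpha>" "\<And>\<alpha> \<gamma>. \<gamma> \<le> \<alpha> \<Longrightarrow> h \<gamma> < s \<alpha>" by metis
  show "cofinal_in UNIV ?E"
    unfolding cofinal_in_def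
  proof (intro conjI ballI)
    fix \<alpha> :: 'a
    define k where "k n = (s ^^ n) \<alpha>" for n
    define \<delta> where "\<delta> = (LEAST \<delta>. \<forall>n. k n < \<delta>)"
    have "\<exists>\<delta>. \<forall>n. k n < \<delta>"
      using image_bounded[OF small_nat, of k] by blast
    then have k: "k n < \<delta>" for n
      unfolding \<delta>_def using LeastI_ex[of "\<lambda>\<delta>. \<forall>n. k n < \<delta>"] by blast
    have ex: "\<exists>n. \<beta> \<le> k n" if "\<beta> < \<delta>" for \<beta>
      using not_less_Least[OF that[unfolded \<delta>_def]] by (meson not_le)
    have step: "k (Suc n) = s (k n)" for n by (simp add: k_def)
    have "is_limit \<delta>"
      unfolding is_limit_def using k ex s(1) step by (metis le_less_trans)
    moreover have "h \<beta> < \<delta>" if "\<beta> < \<delta>" for \<beta>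
      using ex[OF that] s(2) step k by (metis less_trans)
    moreover have "\<alpha> \<le> \<delta>" using k[of 0] by (simp add: k_def)
    ultimately show "\<exists>\<gamma>\<in>?E. \<alpha> \<le> \<gamma>" by blast
  qed simp
  show "closed_in UNIV ?E"
    unfolding closed_in_def
  proof (intro ballI impI)
    fix \<delta> :: 'a
    assume lim: "is_limit \<delta>" and cof: "cofinal_in {..<\<delta>} (?E \<inter> {..<\<delta>})"
    have "h \<alpha> < \<delta>" if "\<alpha> < \<delta>" for \<alpha>
    proof -
      obtain \<epsilon> where "\<epsilon> \<in> ?E" "\<epsilon> < \<delta>" "suc \<alpha> \<le> \<epsilon>"
        using cof suc_less_limit[OF lim \<open>\<alpha> < \<delta>\<close>] unfolding cofinal_in_def by blast
      then show ?thesis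
        using less_suc_iff[of \<alpha> \<alpha>] by (metis (no_types, lifting) mem_Collect_eq dual_order.refl less_le_trans less_trans)
    qed
    with lim show "\<delta> \<in> ?E" by blast
  qed
qed

lemma stationary_closure_point:
  fixes h :: "'a \<Rightarrow> 'a"
  assumes "stationary S"
  obtains \<delta> where "\<delta> \<in> S" "is_limit \<delta>" "\<And>\<alpha>. \<alpha> < \<delta> \<Longrightarrow> h \<alpha> < \<delta>"
  using assms club_closure_points[of h] unfolding stationary_def by blast

text \<open>
  A limit ordinal closed under a function \<open>\<alpha> \<mapsto> min(C - \<alpha>)\<close> is a limit of \<open>C\<close> and hence belongs to
  \<open>C\<close>, so the second club is absorbed into the function.
\<close>

lemma stationary_club_closure_point:
  fixes h :: "'a \<Rightarrow> 'a"
  assumes "stationary S" and C: "club_in UNIV C"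
  obtains \<delta> where "\<delta> \<in> S \<inter> C" "is_limit \<delta>" "\<And>\<alpha>. \<alpha> < \<delta> \<Longrightarrow> h \<alpha> < \<delta>"
proof -
  have "\<forall>\<alpha>. \<exists>\<gamma>\<in>C. \<alpha> \<le> \<gamma>" using C unfolding club_in_def cofinal_in_def by blast
  then obtain k where k: "\<And>\<alpha>. k \<alpha> \<in> C" "\<And>\<alpha>. \<alpha> \<le> k \<alpha>" by metis
  obtain \<delta> where \<delta>: "\<delta> \<in> S" "is_limit \<delta>" "\<And>\<alpha>. \<alpha> < \<delta> \<Longrightarrow> max (h \<alpha>) (k \<alpha>) < \<delta>"
    using stationary_closure_point[OF assms(1), of "\<lambda>\<alpha>. max (h \<alpha>) (k \<alpha>)"] by blast
  have "cofinal_in {..<\<delta>} (C \<inter> {..<\<delta>})"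
    unfolding cofinal_in_def using k \<delta>(3) by fastforce
  then have "\<delta> \<in> C" using C \<delta>(2) unfolding club_in_def closed_in_def by blast
  then show thesis using that \<delta> by auto
qed

lemma unbounded_not_small:
  assumes "\<forall>\<alpha>::'a. \<exists>\<beta>\<in>K. \<alpha> \<le> \<beta>"
  shows "|UNIV :: 'a set| \<le>o |K|"
proof (rule ccontr)
  assume "\<not> ?thesis"
  then have "small K \<kappa>" by (simp add: not_ordLeq_iff_ordLess card_of_Well_order)
  then show False using small_bounded assms by (meson leD)
qed

end

section \<open>Nodes and trees\<close>

abbreviation nodes :: "'a::wellorder node set" where
  "nodes \<equiv> seqs_below UNIV"

definition len :: "'a::wellorder node \<Rightarrow> 'a" where
  "len u = (LEAST \<alpha>. \<alpha> \<notin> dom u)"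

definition trunc :: "'a::wellorder node \<Rightarrow> 'a \<Rightarrow> 'a node" where
  "trunc u \<alpha> = u |` {..<\<alpha>}"

lemma trunc_apply: "trunc u \<alpha> \<xi> = (if \<xi> < \<alpha> then u \<xi> else None)"
  by (simp add: trunc_def restrict_map_def)

lemma len_eqI: "dom u = {..<\<alpha>} \<Longrightarrow> len u = \<alpha>"
  unfolding len_def by (rule Least_equality) (auto simp: not_less)

lemma nodesI: "dom u = {..<\<alpha>} \<Longrightarrow> u \<in> nodes"
  by (auto simp: seqs_below_def)

lemma dom_node: "u \<in> nodes \<Longrightarrow> dom u = {..<len u}"
  unfolding seqs_below_def using len_eqI by blast

lemma node_None_iff: "u \<in> nodes \<Longrightarrow> u \<xi> = None \<longleftrightarrow> len u \<le> \<xi>"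
  using dom_node by (metis domIff lessThan_iff not_le)

lemma map_le_iff_node:
  assumes "u \<in> nodes" "v \<in> nodes"
  shows "u \<subseteq>\<^sub>m v \<longleftrightarrow> len u \<le> len v \<and> (\<forall>\<xi><len u. u \<xi> = v \<xi>)"
proof
  assume "u \<subseteq>\<^sub>m v"
  then show "len u \<le> len v \<and> (\<forall>\<xi><len u. u \<xi> = v \<xi>)"
    using assms by (metis dom_node lessThan_iff lessThan_subset_iff map_le_def map_le_implies_dom_le)
qed (simp add: map_le_def dom_node[OF assms(1)])

lemma dom_trunc: "dom (trunc u \<alpha>) = {..<\<alpha>} \<inter> dom u"
  by (auto simp: trunc_def)

lemma trunc_map_le: "trunc u \<alpha> \<subseteq>\<^sub>m u"
  by (auto simp: trunc_apply map_le_def)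

lemma dom_trunc_node: "u \<in> nodes \<Longrightarrow> \<alpha> \<le> len u \<Longrightarrow> dom (trunc u \<alpha>) = {..<\<alpha>}"
  by (auto simp: dom_trunc dom_node)

lemma trunc_node: "u \<in> nodes \<Longrightarrow> trunc u \<alpha> \<in> nodes"
  by (rule nodesI[of _ "min \<alpha> (len u)"]) (auto simp: dom_trunc dom_node simp del: dom_eq_empty_conv)

lemma len_trunc: "u \<in> nodes \<Longrightarrow> \<alpha> \<le> len u \<Longrightarrow> len (trunc u \<alpha>) = \<alpha>"
  by (simp add: len_eqI dom_trunc_node)

lemma trunc_all:
  assumes "u \<in> nodes" "len u \<le> \<alpha>"
  shows "trunc u \<alpha> = u"
proof
  fix \<xi> show "trunc u \<alpha> \<xi> = u \<xi>"
    using node_None_iff[OF assms(1), of \<xi>] assms(2) by (auto simp: trunc_apply)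
qed

lemma trunc_trunc: "\<beta> \<le> \<alpha> \<Longrightarrow> trunc (trunc u \<alpha>) \<beta> = trunc u \<beta>"
  by (rule ext) (auto simp: trunc_apply)

lemma map_le_eq_trunc:
  assumes "u \<subseteq>\<^sub>m v" "u \<in> nodes" shows "u = trunc v (len u)"
  using assms by (intro ext) (auto simp: trunc_apply map_le_def dom_node node_None_iff)

lemma trunc_mono: "\<alpha> \<le> \<beta> \<Longrightarrow> trunc u \<alpha> \<subseteq>\<^sub>m trunc u \<beta>"
  by (auto simp: trunc_apply map_le_def)

lemma diverge:
  assumes "u \<in> nodes" "v \<in> nodes" "\<not> u \<subseteq>\<^sub>m v" "\<not> v \<subseteq>\<^sub>m u"
  obtains \<xi> where "\<xi> < len u" "\<xi> < len v" "trunc u \<xi> = trunc v \<xi>" "u \<xi> \<noteq> v \<xi>"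
proof -
  define \<xi> where "\<xi> = (LEAST \<xi>. u \<xi> \<noteq> v \<xi>)"
  have "\<exists>\<xi>. \<xi> < min (len u) (len v) \<and> u \<xi> \<noteq> v \<xi>"
    using assms map_le_iff_node[OF assms(1,2)] map_le_iff_node[OF assms(2,1)]
    by (cases "len u \<le> len v") (auto simp: min_def)
  then obtain \<zeta> where \<zeta>: "\<zeta> < min (len u) (len v)" "u \<zeta> \<noteq> v \<zeta>" by blast
  have 1: "u \<xi> \<noteq> v \<xi>" "\<xi> \<le> \<zeta>"
    unfolding \<xi>_def using LeastI[of "\<lambda>\<xi>. u \<xi> \<noteq> v \<xi>", OF \<zeta>(2)] Least_le[of "\<lambda>\<xi>. u \<xi> \<noteq> v \<xi>", OF \<zeta>(2)]
    by auto
  moreover have "trunc u \<xi> = trunc v \<xi>"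
    by (rule ext) (auto simp: trunc_apply \<xi>_def dest: not_less_Least)
  moreover have "\<xi> < len u" "\<xi> < len v" using 1(2) \<zeta>(1) by auto
  ultimately show thesis using that by blast
qed

lemma snoc_apply: "snoc u b = u(len u \<mapsto> b)"
  by (simp add: snoc_def len_def)

lemma snoc_neq: "snoc u False \<noteq> snoc u True"
  by (metis snoc_apply fun_upd_same option.inject)

lemma split_iff: "u \<in> split p \<longleftrightarrow> u \<in> p \<and> snoc u False \<in> p \<and> snoc u True \<in> p"
proof -
  let ?A = "{\<nu>\<in>p. \<exists>b. \<nu> = snoc u b}"
  have *: "?A = (if snoc u False \<in> p then {snoc u False} else {}) \<union>
      (if snoc u True \<in> p then {snoc u True} else {})"
    by (auto simp: ex_bool_eq)
  show ?thesis
    by (cases "snoc u False \<in> p"; cases "snoc u True \<in> p")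
      (simp_all add: split_def * snoc_neq snoc_neq[symmetric])
qed

lemma split_mono: "p \<subseteq> q \<Longrightarrow> split p \<subseteq> split q"
  by (auto simp: split_iff)

lemma split_subset: "split p \<subseteq> p"
  by (auto simp: split_iff)

text \<open>
  The value at a point comes from an arbitrary member of the family defined there. The choice does not
  matter when the members are pairwise comparable, and then the graph is the union of the graphs.
\<close>

definition union_of :: "('b \<rightharpoonup> 'c) set \<Rightarrow> ('b \<rightharpoonup> 'c)" where
  "union_of A \<xi> = (if \<exists>n\<in>A. \<xi> \<in> dom n then (SOME n. n \<in> A \<and> \<xi> \<in> dom n) \<xi> else None)"

lemma union_of_Some:
  assumes "\<And>m n. m \<in> A \<Longrightarrow> n \<in> A \<Longrightarrow> m \<subseteq>\<^sub>m n \<or> n \<subseteq>\<^sub>m m" and "n \<in> A" "n \<xi> = Some v"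
  shows "union_of A \<xi> = Some v"
proof -
  define m where "m = (SOME n. n \<in> A \<and> \<xi> \<in> dom n)"
  have m: "m \<in> A \<and> \<xi> \<in> dom m"
    unfolding m_def by (rule someI[of _ n]) (use assms in auto)
  then have "m \<xi> = n \<xi>" using assms(1)[of m n] assms(2,3)
    unfolding map_le_def by (metis domI)
  then show ?thesis
    unfolding union_of_def m_def[symmetric] using assms by auto
qed

lemma dom_union_of: "dom (union_of A) = (\<Union>n\<in>A. dom n)"
proof -
  have "\<xi> \<in> dom (union_of A) \<longleftrightarrow> (\<exists>n\<in>A. \<xi> \<in> dom n)" for \<xi>
  proof (cases "\<exists>n\<in>A. \<xi> \<in> dom n")
    case True
    then have "\<xi> \<in> dom (SOME n. n \<in> A \<and> \<xi> \<in> dom n)"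
      using someI_ex[of "\<lambda>n. n \<in> A \<and> \<xi> \<in> dom n"] by blast
    then show ?thesis using True by (simp add: union_of_def domIff)
  qed (simp add: union_of_def domIff)
  then show ?thesis by (intro set_eqI) simp
qed

lemma map_le_union_of:
  assumes "\<And>m n. m \<in> A \<Longrightarrow> n \<in> A \<Longrightarrow> m \<subseteq>\<^sub>m n \<or> n \<subseteq>\<^sub>m m" and "n \<in> A"
  shows "n \<subseteq>\<^sub>m union_of A"
  using union_of_Some[OF assms] unfolding map_le_def dom_def by fastforce

lemma union_of_map_le:
  assumes "\<And>n. n \<in> A \<Longrightarrow> n \<subseteq>\<^sub>m w"
  shows "union_of A \<subseteq>\<^sub>m w"
  unfolding map_le_def
proof
  fix \<xi> assume \<xi>: "\<xi> \<in> dom (union_of A)"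
  then have ex: "\<exists>n\<in>A. \<xi> \<in> dom n" unfolding dom_union_of by blast
  define n where "n = (SOME n. n \<in> A \<and> \<xi> \<in> dom n)"
  have "n \<in> A \<and> \<xi> \<in> dom n" unfolding n_def by (rule someI_ex[OF ex[unfolded Bex_def]])
  moreover have "union_of A \<xi> = n \<xi>" using ex by (simp add: union_of_def n_def)
  ultimately show "union_of A \<xi> = w \<xi>" using assms unfolding map_le_def by metis
qed

lemma map_le_eqI:
  assumes "u \<subseteq>\<^sub>m w" "v \<subseteq>\<^sub>m w" "dom u = dom v"
  shows "u = v"
proof
  fix \<xi> show "u \<xi> = v \<xi>"
    using assms unfolding map_le_def by (cases "\<xi> \<in> dom u") (metis, metis domIff)
qed

lemma graph_union_of:
  assumes "\<And>m n. m \<in> A \<Longrightarrow> n \<in> A \<Longrightarrow> m \<subseteq>\<^sub>m n \<or> n \<subseteq>\<^sub>m m"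
  shows "Map.graph (union_of A) = (\<Union>n\<in>A. Map.graph n)"
proof -
  have "union_of A \<xi> = Some v \<longleftrightarrow> (\<exists>n\<in>A. n \<xi> = Some v)" for \<xi> v
  proof
    assume 1: "union_of A \<xi> = Some v"
    then obtain n w where "n \<in> A" "n \<xi> = Some w"
      using dom_union_of[of A] by blast
    then show "\<exists>n\<in>A. n \<xi> = Some v"
      using union_of_Some[OF assms] 1 by fastforce
  qed (use union_of_Some[OF assms] in blast)
  then show ?thesis unfolding Map.graph_def by auto
qed

lemma graph_inject: "Map.graph u = Map.graph v \<longleftrightarrow> u = v"
proof
  assume *: "Map.graph u = Map.graph v"
  have "u x = Some y \<longleftrightarrow> v x = Some y" for x y
    using * unfolding Map.graph_def set_eq_iff by blast
  then show "u = v" by (metis ext not_Some_eq)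
qed simp

lemma graph_mono: "u \<subseteq>\<^sub>m v \<Longrightarrow> Map.graph u \<subseteq> Map.graph v"
  by (force simp: Map.graph_def map_le_def dom_def)

lemma tree_nodes: "is_tree p \<Longrightarrow> u \<in> p \<Longrightarrow> u \<in> nodes"
  by (auto simp: is_tree_def)

lemma tree_down: "is_tree p \<Longrightarrow> u \<in> p \<Longrightarrow> v \<in> nodes \<Longrightarrow> v \<subseteq>\<^sub>m u \<Longrightarrow> v \<in> p"
  by (auto simp: is_tree_def)

lemma tree_trunc: "is_tree p \<Longrightarrow> u \<in> p \<Longrightarrow> trunc u \<alpha> \<in> p"
  by (meson trunc_map_le trunc_node tree_down tree_nodes)

lemma empty_node: "Map.empty \<in> nodes"
proof -
  define z :: 'a where "z = (LEAST x. True)"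
  have "dom Map.empty = {..<z}"
    using Least_le[of "\<lambda>_. True"] by (force simp: z_def not_less[symmetric])
  then show ?thesis by (rule nodesI)
qed

lemma tree_empty: "is_tree p \<Longrightarrow> Map.empty \<in> p"
proof -
  assume t: "is_tree p"
  then obtain u where "u \<in> p" unfolding is_tree_def by blast
  then show ?thesis using tree_down[OF t _ empty_node] by simp
qed

section \<open>Collapsing well-ordered sets\<close>

text \<open>
  If \<open>c\<close> and \<open>H\<close> have the same order type, this recursion computes the isomorphism from \<open>c\<close> onto
  \<open>H\<close>; for \<open>H = UNIV\<close> it is the collapse of \<open>c\<close> onto an ordinal. In contrast to an isomorphism obtained by
  choice, its value at \<open>\<beta>\<close> depends on \<open>c \<inter> \<beta>\<close> only.
\<close>

function rank_into :: "'a::wellorder set \<Rightarrow> 'a set \<Rightarrow> 'a \<Rightarrow> 'a" where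
  "rank_into H c \<beta> = (LEAST h. h \<in> H \<and> (\<forall>\<gamma>\<in>{\<gamma>\<in>c. \<gamma> < \<beta>}. rank_into H c \<gamma> < h))"
  by auto
termination
  by (relation "inv_image {(x, y). x < y} (\<lambda>(H, c, \<beta>). \<beta>)") (auto simp: wellorder_class.wf)

declare rank_into.simps [simp del]

lemma rank_into_cong:
  "(\<And>\<gamma>. \<gamma> < \<beta> \<Longrightarrow> \<gamma> \<in> c \<longleftrightarrow> \<gamma> \<in> c') \<Longrightarrow> rank_into H c \<beta> = rank_into H c' \<beta>"
proof (induction \<beta> rule: less_induct)
  case (less \<beta>)
  then have "rank_into H c \<gamma> = rank_into H c' \<gamma>" if "\<gamma> < \<beta>" for \<gamma>
    using that by (meson less_trans)
  then have "(\<lambda>h. h \<in> H \<and> (\<forall>\<gamma>\<in>{\<gamma>\<in>c. \<gamma> < \<beta>}. rank_into H c \<gamma> < h)) =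
     (\<lambda>h. h \<in> H \<and> (\<forall>\<gamma>\<in>{\<gamma>\<in>c'. \<gamma> < \<beta>}. rank_into H c' \<gamma> < h))"
    using less.prems by (intro ext) auto
  then show ?case
    by (subst (1 2) rank_into.simps) simp
qed

lemma rank_into_eq_iso:
  assumes bij: "bij_betw \<phi> c H" and mono: "\<And>\<beta> \<gamma>. \<beta> \<in> c \<Longrightarrow> \<gamma> \<in> c \<Longrightarrow> \<gamma> < \<beta> \<Longrightarrow> \<phi> \<gamma> < \<phi> \<beta>"
    and "\<beta> \<in> c"
  shows "rank_into H c \<beta> = \<phi> \<beta>"
  using \<open>\<beta> \<in> c\<close>
proof (induction \<beta> rule: less_induct)
  case (less \<beta>)
  show ?case
  proof (subst rank_into.simps, rule Least_equality)
    show "\<phi> \<beta> \<in> H \<and> (\<forall>\<gamma>\<in>{\<gamma> \<in> c. \<gamma> < \<beta>}. rank_into H c \<gamma> < \<phi> \<beta>)"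
      using less bij mono by (auto simp: bij_betw_def)
    fix h assume h: "h \<in> H \<and> (\<forall>\<gamma>\<in>{\<gamma> \<in> c. \<gamma> < \<beta>}. rank_into H c \<gamma> < h)"
    then obtain \<gamma> where \<gamma>: "\<gamma> \<in> c" "h = \<phi> \<gamma>" using bij by (auto simp: bij_betw_def)
    then have "\<not> \<gamma> < \<beta>" using h less.IH by auto
    then show "\<phi> \<beta> \<le> h" using mono[of \<gamma> \<beta>] \<gamma> less.prems
      by (cases "\<gamma> = \<beta>") (auto simp: neq_iff less_imp_le)
  qed
qed

lemma rank_into_UNIV:
  "rank_into UNIV c \<beta> \<le> \<beta>"
  "\<gamma> \<in> c \<Longrightarrow> \<gamma> < \<beta> \<Longrightarrow> rank_into UNIV c \<gamma> < rank_into UNIV c \<beta>"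
  "x < rank_into UNIV c \<beta> \<Longrightarrow> \<exists>\<gamma>\<in>c. \<gamma> < \<beta> \<and> x = rank_into UNIV c \<gamma>"
proof -
  let ?r = "rank_into UNIV c"
  let ?Q = "\<lambda>\<beta> h. \<forall>\<gamma>\<in>{\<gamma>\<in>c. \<gamma> < \<beta>}. ?r \<gamma> < h"
  have r: "?r \<beta> = (LEAST h. ?Q \<beta> h)" for \<beta>
    by (subst rank_into.simps) simp
  show le: "?r \<beta> \<le> \<beta>" for \<beta>
  proof (induction \<beta> rule: less_induct)
    case (less \<beta>)
    then have "?Q \<beta> \<beta>" by (auto intro: le_less_trans)
    then show ?case unfolding r[of \<beta>] by (rule Least_le)
  qed
  have Q: "?Q \<beta> (?r \<beta>)" for \<beta>
  proof -
    have "?Q \<beta> \<beta>" using le by (auto intro: le_less_trans)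
    then show ?thesis unfolding r[of \<beta>] by (rule LeastI)
  qed
  show "\<gamma> \<in> c \<Longrightarrow> \<gamma> < \<beta> \<Longrightarrow> ?r \<gamma> < ?r \<beta>" using Q by blast
  show "x < ?r \<beta> \<Longrightarrow> \<exists>\<gamma>\<in>c. \<gamma> < \<beta> \<and> x = ?r \<gamma>" for x
  proof (induction \<beta> rule: less_induct)
    case (less \<beta>)
    have "x < (LEAST h. ?Q \<beta> h)" using less.prems r[of \<beta>] by simp
    then have "\<not> ?Q \<beta> x" by (rule not_less_Least)
    then obtain \<gamma> where \<gamma>: "\<gamma> \<in> c" "\<gamma> < \<beta>" "x \<le> ?r \<gamma>" by auto
    then show ?case using less.IH[of \<gamma>] by (meson le_less less_trans)
  qed
qed

text \<open>
  The enumeration is the inverse of the collapse, which does not increase ordinals and so maps \<open>K\<close> below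
  \<open>\<theta>\<close>.
\<close>

lemma enumerate_bounded:
  fixes K :: "'a::wellorder set"
  assumes "K \<subseteq> {..<\<theta>}"
  obtains \<delta> :: 'a and e :: "'a \<Rightarrow> 'a" where "e ` {..<\<delta>} = K"
    "\<And>\<epsilon> \<zeta>. \<epsilon> < \<zeta> \<Longrightarrow> \<zeta> < \<delta> \<Longrightarrow> e \<epsilon> < e \<zeta>"
proof -
  define r where "r = rank_into UNIV K"
  define \<delta> where "\<delta> = r \<theta>"
  have im: "r ` K = {..<\<delta>}"
    using rank_into_UNIV(2,3)[of _ K \<theta>] assms by (fastforce simp: \<delta>_def r_def)
  have mono: "\<beta> \<in> K \<Longrightarrow> \<gamma> \<in> K \<Longrightarrow> r \<beta> < r \<gamma> \<longleftrightarrow> \<beta> < \<gamma>" for \<beta> \<gamma>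
    unfolding r_def by (metis rank_into_UNIV(2) less_asym linorder_neqE)
  have inj: "inj_on r K" by (rule inj_onI) (metis mono less_irrefl linorder_neqE)
  define e where "e = inv_into K r"
  have "e ` {..<\<delta>} = K" unfolding e_def im[symmetric] using inj by simp
  moreover have "e \<epsilon> < e \<zeta>" if "\<epsilon> < \<zeta>" "\<zeta> < \<delta>" for \<epsilon> \<zeta>
  proof -
    have "\<epsilon> \<in> r ` K" "\<zeta> \<in> r ` K" using im that by auto
    then show ?thesis unfolding e_def
      using mono[OF inv_into_into[of \<epsilon> r K] inv_into_into[of \<zeta> r K]] that(1) by (simp add: f_inv_into_f)
  qed
  ultimately show thesis by (rule that)
qed

section \<open>Conditions in terms of truncations\<close>

text \<open>
  Closure under increasing unions, and the closure of the splitting nodes at levels in \<open>W\<close>, expressed by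
  the truncations of a single node in place of increasing sequences of nodes.
\<close>

definition limit_closed :: "'a::wellorder node set \<Rightarrow> bool" where
  "limit_closed p \<longleftrightarrow> (\<forall>u \<theta>. is_limit \<theta> \<longrightarrow> dom u = {..<\<theta>} \<longrightarrow> (\<forall>\<alpha><\<theta>. trunc u \<alpha> \<in> p) \<longrightarrow> u \<in> p)"

definition split_closed :: "'a::wellorder set \<Rightarrow> 'a node set \<Rightarrow> bool" where
  "split_closed W p \<longleftrightarrow> (\<forall>u\<in>p. len u \<in> W \<longrightarrow> is_limit (len u) \<longrightarrow>
     (\<forall>\<alpha><len u. \<exists>\<beta><len u. \<alpha> \<le> \<beta> \<and> trunc u \<beta> \<in> split p) \<longrightarrow> u \<in> split p)"

context regular_cardinal
begin

lemma dom_snoc: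
  fixes u :: "'a node"
  shows "u \<in> nodes \<Longrightarrow> dom (snoc u b) = {..<suc (len u)}"
  by (simp add: snoc_apply dom_node lessThan_suc)

lemma len_snoc: "(u :: 'a node) \<in> nodes \<Longrightarrow> len (snoc u b) = suc (len u)"
  by (rule len_eqI[OF dom_snoc])

lemma map_le_snoc: "(u :: 'a node) \<in> nodes \<Longrightarrow> u \<subseteq>\<^sub>m snoc u b"
  by (auto simp: snoc_apply map_le_def dom_node)

lemma trunc_suc:
  fixes v :: "'a node"
  assumes "v \<in> nodes" "\<xi> < len v" "v \<xi> = Some b"
  shows "trunc v (suc \<xi>) = snoc (trunc v \<xi>) b"
proof -
  have "len (trunc v \<xi>) = \<xi>" using assms by (simp add: len_trunc)
  then show ?thesis using assms
    by (intro ext) (auto simp: snoc_apply trunc_apply order_le_less)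
qed

text \<open>
  Regularity of \<open>\<kappa>\<close> makes the union a node: the lengths of the members are bounded.
\<close>

lemma increasing_union:
  fixes \<eta> :: "'a \<Rightarrow> 'a node"
  assumes inc: "increasing_below \<delta> \<eta>" and lim: "is_limit \<delta>" and nd: "\<And>\<epsilon>. \<epsilon> < \<delta> \<Longrightarrow> \<eta> \<epsilon> \<in> nodes"
  obtains u \<theta> where "is_limit \<theta>" "dom u = {..<\<theta>}" "is_union_below \<delta> \<eta> u"
    "\<forall>\<epsilon><\<delta>. len (\<eta> \<epsilon>) < \<theta> \<and> trunc u (len (\<eta> \<epsilon>)) = \<eta> \<epsilon>"
    "\<forall>\<beta><\<theta>. \<exists>\<epsilon><\<delta>. \<beta> \<le> len (\<eta> \<epsilon>)"
proof -
  define A where "A = \<eta> ` {..<\<delta>}"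
  define u where "u = union_of A"
  have chain: "m \<subseteq>\<^sub>m n \<or> n \<subseteq>\<^sub>m m" if "m \<in> A" "n \<in> A" for m n
  proof -
    obtain \<epsilon> \<zeta> where "m = \<eta> \<epsilon>" "n = \<eta> \<zeta>" "\<epsilon> < \<delta>" "\<zeta> < \<delta>"
      using \<open>m \<in> A\<close> \<open>n \<in> A\<close> unfolding A_def by blast
    then show ?thesis using inc unfolding increasing_below_def
      by (cases \<epsilon> \<zeta> rule: linorder_cases) auto
  qed
  have lt: "len (\<eta> \<epsilon>) < len (\<eta> \<zeta>)" if "\<epsilon> < \<zeta>" "\<zeta> < \<delta>" for \<epsilon> \<zeta>
  proof -
    have *: "\<eta> \<epsilon> \<subseteq>\<^sub>m \<eta> \<zeta>" "\<eta> \<epsilon> \<noteq> \<eta> \<zeta>" "\<eta> \<epsilon> \<in> nodes" "\<eta> \<zeta> \<in> nodes"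
      using inc that nd unfolding increasing_below_def by auto
    then have "len (\<eta> \<epsilon>) \<noteq> len (\<eta> \<zeta>)"
      by (metis trunc_all map_le_eq_trunc order.refl)
    then show ?thesis using * by (simp add: map_le_iff_node order_less_le)
  qed
  define \<theta> where "\<theta> = (LEAST \<theta>. \<forall>\<epsilon>\<in>{..<\<delta>}. len (\<eta> \<epsilon>) < \<theta>)"
  have \<theta>: "\<forall>\<epsilon>\<in>{..<\<delta>}. len (\<eta> \<epsilon>) < \<theta>"
    unfolding \<theta>_def by (rule LeastI_ex[OF image_bounded[OF small_lessThan]])
  have cof: "\<exists>\<epsilon><\<delta>. \<beta> \<le> len (\<eta> \<epsilon>)" if "\<beta> < \<theta>" for \<beta>
    using not_less_Least[OF that[unfolded \<theta>_def]] by (auto simp: not_less)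
  obtain \<epsilon>0 where "\<epsilon>0 < \<delta>" using lim is_limit_def by blast
  have lim_sup: "is_limit \<theta>"
    unfolding is_limit_def
  proof (intro conjI allI impI)
    show "\<exists>\<beta>. \<beta> < \<theta>" using \<theta> \<open>\<epsilon>0 < \<delta>\<close> by auto
    fix \<beta> assume "\<beta> < \<theta>"
    then obtain \<epsilon> where \<epsilon>: "\<epsilon> < \<delta>" "\<beta> \<le> len (\<eta> \<epsilon>)" using cof by blast
    then obtain \<zeta> where "\<epsilon> < \<zeta>" "\<zeta> < \<delta>" using lim is_limit_def by blast
    then show "\<exists>\<gamma><\<theta>. \<beta> < \<gamma>" using lt \<theta> \<epsilon> by (meson le_less_trans lessThan_iff)
  qed
  have "dom u = (\<Union>\<epsilon>\<in>{..<\<delta>}. {..<len (\<eta> \<epsilon>)})"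
    unfolding u_def dom_union_of A_def using nd by (auto simp: dom_node)
  also have "\<dots> = {..<\<theta>}"
  proof (intro equalityI subsetI)
    fix \<beta> assume "\<beta> \<in> {..<\<theta>}"
    then obtain \<gamma> where "\<beta> < \<gamma>" "\<gamma> < \<theta>" using lim_sup is_limit_def by blast
    then show "\<beta> \<in> (\<Union>\<epsilon>\<in>{..<\<delta>}. {..<len (\<eta> \<epsilon>)})" using cof[of \<gamma>] by (auto intro: less_le_trans)
  qed (use \<theta> in \<open>auto intro: less_trans\<close>)
  finally have dom: "dom u = {..<\<theta>}" .
  moreover have "is_union_below \<delta> \<eta> u"
  proof -
    have "Map.graph (union_of A) = (\<Union>n\<in>A. Map.graph n)" by (rule graph_union_of[OF chain])
    then show ?thesis unfolding is_union_below_def u_def A_def by auto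
  qed
  moreover have "trunc u (len (\<eta> \<epsilon>)) = \<eta> \<epsilon>" if "\<epsilon> < \<delta>" for \<epsilon>
    using map_le_eq_trunc[OF map_le_union_of[OF chain]] that nd unfolding u_def A_def by fastforce
  ultimately show thesis using that lim_sup cof \<theta> by blast
qed

text \<open>
  From left to right, the sequences to use are all truncations of \<open>u\<close>, respectively its splitting
  truncations in increasing order. From right to left, each truncation of the union of an increasing
  sequence of limit length is an initial segment of a member of the sequence, and the members are
  themselves truncations of the union.
\<close>

lemma sacks_iff:
  fixes p :: "'a node set"
  shows "p \<in> sacks W \<longleftrightarrow>
    is_tree p \<and> limit_closed p \<and> (\<forall>\<eta>\<in>p. \<exists>\<nu>\<in>split p. \<eta> \<subseteq>\<^sub>m \<nu>) \<and> split_closed W p" (is "_ \<longleftrightarrow> ?R")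
proof
  assume p: "p \<in> sacks W"
  then have t: "is_tree p"
    and un: "\<And>\<delta> \<eta>. increasing_below \<delta> \<eta> \<Longrightarrow> (\<forall>\<epsilon><\<delta>. \<eta> \<epsilon> \<in> p) \<Longrightarrow> \<exists>u\<in>p. is_union_below \<delta> \<eta> u"
    and sp: "\<And>\<delta> \<eta>. is_limit \<delta> \<Longrightarrow> increasing_below \<delta> \<eta> \<Longrightarrow> (\<forall>\<epsilon><\<delta>. \<eta> \<epsilon> \<in> split p) \<Longrightarrow>
        (\<exists>\<theta>\<in>W. {..<\<theta>} = (\<Union>\<epsilon><\<delta>. dom (\<eta> \<epsilon>))) \<Longrightarrow> \<exists>u\<in>split p. is_union_below \<delta> \<eta> u"
    and sd: "\<forall>\<eta>\<in>p. \<exists>\<nu>\<in>p. \<eta> \<subseteq>\<^sub>m \<nu> \<and> snoc \<nu> False \<in> p \<and> snoc \<nu> True \<in> p"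
    unfolding sacks_def by blast+
  have "\<forall>\<eta>\<in>p. \<exists>\<nu>\<in>split p. \<eta> \<subseteq>\<^sub>m \<nu>"
    using sd unfolding split_iff Bex_def by meson
  moreover have union_cuts: "v = u"
    if u: "u \<in> nodes" and lim: "is_limit (len u)" and K: "K \<subseteq> {..<len u}" "\<forall>\<alpha><len u. \<exists>\<beta>\<in>K. \<alpha> \<le> \<beta>"
      and e: "e ` {..<\<delta>} = K" and v: "is_union_below \<delta> (\<lambda>\<epsilon>. trunc u (e \<epsilon>)) v"
    for u v K \<delta> and e :: "'a \<Rightarrow> 'a"
  proof -
    have "Map.graph v = (\<Union>\<beta>\<in>K. Map.graph (trunc u \<beta>))"
      using v e unfolding is_union_below_def by auto
    also have "\<dots> = Map.graph u"
    proof (intro equalityI subsetI)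
      fix z assume "z \<in> Map.graph u"
      then obtain \<xi> b where z: "z = (\<xi>, b)" "u \<xi> = Some b" unfolding Map.graph_def by blast
      then have "\<xi> < len u" using dom_node[OF u] by auto
      then obtain \<beta> where "\<beta> \<in> K" "\<xi> < \<beta>"
        using lim K unfolding is_limit_def by (meson less_le_trans)
      then show "z \<in> (\<Union>\<beta>\<in>K. Map.graph (trunc u \<beta>))"
        using z by (auto simp: Map.graph_def trunc_apply)
    qed (auto simp: Map.graph_def trunc_apply split: if_splits)
    finally show ?thesis by (simp add: graph_inject)
  qed
  moreover have inc: "increasing_below \<delta> (\<lambda>\<epsilon>. trunc u (e \<epsilon>))"
    if "u \<in> nodes" "e ` {..<\<delta>} \<subseteq> {..<len u}" "\<And>\<epsilon> \<zeta>. \<epsilon> < \<zeta> \<Longrightarrow> \<zeta> < \<delta> \<Longrightarrow> e \<epsilon> < e \<zeta>"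
    for u \<delta> and e :: "'a \<Rightarrow> 'a"
    unfolding increasing_below_def
  proof (intro allI impI conjI)
    fix \<epsilon> \<zeta> assume *: "\<epsilon> < \<zeta> \<and> \<zeta> < \<delta>"
    then have 1: "e \<epsilon> < e \<zeta>" "e \<zeta> < len u" using that by auto
    then show "trunc u (e \<epsilon>) \<subseteq>\<^sub>m trunc u (e \<zeta>)" by (simp add: trunc_mono)
    show "trunc u (e \<epsilon>) \<noteq> trunc u (e \<zeta>)"
      using 1 that(1) by (metis len_trunc less_imp_le less_irrefl less_trans)
  qed
  have "limit_closed p"
    unfolding limit_closed_def
  proof (intro allI impI)
    fix u \<theta> assume *: "is_limit \<theta>" "dom u = {..<\<theta>}" "\<forall>\<alpha><\<theta>. trunc u \<alpha> \<in> p"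
    then have u: "u \<in> nodes" "len u = \<theta>" by (auto simp: nodesI len_eqI)
    obtain v where v: "v \<in> p" "is_union_below \<theta> (\<lambda>\<epsilon>. trunc u (id \<epsilon>)) v"
      using un[OF inc[OF u(1), of id \<theta>]] u * by auto
    have "v = u"
      by (rule union_cuts[OF u(1) _ _ _ _ v(2), of "{..<\<theta>}"]) (use u * in auto)
    then show "u \<in> p" using v by simp
  qed
  moreover have "split_closed W p"
    unfolding split_closed_def
  proof (intro ballI impI)
    fix u assume *: "u \<in> p" "len u \<in> W" "is_limit (len u)"
      "\<forall>\<alpha><len u. \<exists>\<beta><len u. \<alpha> \<le> \<beta> \<and> trunc u \<beta> \<in> split p"
    have u: "u \<in> nodes" using t * tree_nodes by blast
    define K where "K = {\<beta>. \<beta> < len u \<and> trunc u \<beta> \<in> split p}"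
    have K: "K \<subseteq> {..<len u}" "\<forall>\<alpha><len u. \<exists>\<beta>\<in>K. \<alpha> \<le> \<beta>" using * by (auto simp: K_def)
    obtain \<delta> :: 'a and e :: "'a \<Rightarrow> 'a"
      where e: "e ` {..<\<delta>} = K" "\<And>\<epsilon> \<zeta>. \<epsilon> < \<zeta> \<Longrightarrow> \<zeta> < \<delta> \<Longrightarrow> e \<epsilon> < e \<zeta>"
      by (rule enumerate_bounded[OF K(1)]) (erule that)
    have lim: "is_limit \<delta>"
      unfolding is_limit_def
    proof (intro conjI allI impI)
      show "\<exists>\<beta>. \<beta> < \<delta>" using e(1) K(2) *(3) unfolding is_limit_def by (metis image_iff lessThan_iff)
      fix \<epsilon> assume "\<epsilon> < \<delta>"
      then have "e \<epsilon> < len u" using e(1) K(1) by auto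
      then obtain \<beta> where "\<beta> \<in> K" "e \<epsilon> < \<beta>"
        using *(3) K unfolding is_limit_def by (meson less_le_trans)
      then obtain \<zeta> where "\<zeta> < \<delta>" "e \<epsilon> < e \<zeta>" using e(1) by auto
      then show "\<exists>\<zeta><\<delta>. \<epsilon> < \<zeta>"
        using e(2)[of \<zeta> \<epsilon>] \<open>\<epsilon> < \<delta>\<close> by (metis less_asym less_irrefl linorder_neqE)
    qed
    have "{..<len u} = (\<Union>\<epsilon><\<delta>. dom (trunc u (e \<epsilon>)))"
    proof -
      have "(\<Union>\<epsilon><\<delta>. dom (trunc u (e \<epsilon>))) = (\<Union>\<beta>\<in>K. dom (trunc u \<beta>))"
        using e(1) by auto
      also have "\<dots> = (\<Union>\<beta>\<in>K. {..<\<beta>})"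
        by (intro SUP_cong refl dom_trunc_node[OF u]) (use K(1) in force)
      also have "\<dots> = {..<len u}"
      proof (intro equalityI subsetI)
        fix \<xi> assume "\<xi> \<in> {..<len u}"
        then show "\<xi> \<in> (\<Union>\<beta>\<in>K. {..<\<beta>})"
          using *(3) K(2) unfolding is_limit_def by (metis UN_iff lessThan_iff less_le_trans)
      qed (use K(1) in \<open>auto intro: less_trans\<close>)
      finally show ?thesis by simp
    qed
    then have W: "\<exists>\<theta>\<in>W. {..<\<theta>} = (\<Union>\<epsilon><\<delta>. dom (trunc u (e \<epsilon>)))" using *(2) by blast
    have s: "\<forall>\<epsilon><\<delta>. trunc u (e \<epsilon>) \<in> split p" using e(1) by (auto simp: K_def)
    have "increasing_below \<delta> (\<lambda>\<epsilon>. trunc u (e \<epsilon>))"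
      by (rule inc[OF u _ e(2)]) (use e(1) K(1) in auto)
    then obtain v where v: "v \<in> split p" "is_union_below \<delta> (\<lambda>\<epsilon>. trunc u (e \<epsilon>)) v"
      using sp[OF lim _ s W] by auto
    have "v = u" by (rule union_cuts[OF u *(3) K e(1) v(2)])
    then show "u \<in> split p" using v by simp
  qed
  ultimately show ?R using t by blast
next
  assume R: ?R
  then have t: "is_tree p" and lc: "limit_closed p" and sd: "\<forall>\<eta>\<in>p. \<exists>\<nu>\<in>split p. \<eta> \<subseteq>\<^sub>m \<nu>"
    and sc: "split_closed W p" by auto
  have lim_case: "\<exists>u \<theta>. u \<in> p \<and> is_union_below \<delta> \<eta> u \<and> dom u = {..<\<theta>} \<and> is_limit \<theta> \<and>
     (\<forall>\<epsilon><\<delta>. len (\<eta> \<epsilon>) < \<theta> \<and> trunc u (len (\<eta> \<epsilon>)) = \<eta> \<epsilon>) \<and> (\<forall>\<beta><\<theta>. \<exists>\<epsilon><\<delta>. \<beta> \<le> len (\<eta> \<epsilon>))"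
    if inc: "increasing_below \<delta> \<eta>" and in_p: "\<forall>\<epsilon><\<delta>. \<eta> \<epsilon> \<in> p" and lim: "is_limit \<delta>" for \<delta> \<eta>
  proof -
    have nd: "\<And>\<epsilon>. \<epsilon> < \<delta> \<Longrightarrow> \<eta> \<epsilon> \<in> nodes" using in_p t tree_nodes by blast
    obtain u \<theta> where u: "is_limit \<theta>" "dom u = {..<\<theta>}" "is_union_below \<delta> \<eta> u"
      "\<forall>\<epsilon><\<delta>. len (\<eta> \<epsilon>) < \<theta> \<and> trunc u (len (\<eta> \<epsilon>)) = \<eta> \<epsilon>"
      "\<forall>\<beta><\<theta>. \<exists>\<epsilon><\<delta>. \<beta> \<le> len (\<eta> \<epsilon>)"
      using increasing_union[OF inc lim nd] by metis
    have "trunc u \<alpha> \<in> p" if "\<alpha> < \<theta>" for \<alpha>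
    proof -
      obtain \<epsilon> where "\<epsilon> < \<delta>" "\<alpha> \<le> len (\<eta> \<epsilon>)" using u(5) \<open>\<alpha> < \<theta>\<close> by blast
      then show ?thesis using u(4) in_p tree_trunc[OF t] by (metis trunc_trunc)
    qed
    then have "u \<in> p" using lc u unfolding limit_closed_def by blast
    then show ?thesis using u by blast
  qed
  have un: "\<exists>u\<in>p. is_union_below \<delta> \<eta> u"
    if inc: "increasing_below \<delta> \<eta>" and in_p: "\<forall>\<epsilon><\<delta>. \<eta> \<epsilon> \<in> p" for \<delta> \<eta>
  proof (cases "is_limit \<delta>")
    case True
    then show ?thesis using lim_case[OF inc in_p] by blast
  next
    case False
    then show ?thesis
    proof (cases rule: not_limit_cases)
      case 1
      then show ?thesis
        by (intro bexI[OF _ tree_empty[OF t]]) (simp add: is_union_below_def Map.graph_def)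
    next
      case (2 \<alpha>)
      have "\<eta> \<epsilon> \<subseteq>\<^sub>m \<eta> \<alpha>" if "\<epsilon> < \<delta>" for \<epsilon>
        using inc that 2 unfolding increasing_below_def by (metis less_suc_iff map_le_refl order.refl order_le_less)
      then have "Map.graph (\<eta> \<epsilon>) \<subseteq> Map.graph (\<eta> \<alpha>)" if "\<epsilon> < \<delta>" for \<epsilon>
        using that by (simp add: graph_mono)
      then have "is_union_below \<delta> \<eta> (\<eta> \<alpha>)"
        unfolding is_union_below_def 2 by (fastforce dest: subsetD)
      then show ?thesis using in_p 2 by auto
    qed
  qed
  have sp: "\<exists>u\<in>split p. is_union_below \<delta> \<eta> u"
    if lim: "is_limit \<delta>" and inc: "increasing_below \<delta> \<eta>" and sp: "\<forall>\<epsilon><\<delta>. \<eta> \<epsilon> \<in> split p"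
      and W: "\<exists>\<theta>\<in>W. {..<\<theta>} = (\<Union>\<epsilon><\<delta>. dom (\<eta> \<epsilon>))" for \<delta> \<eta>
  proof -
    obtain u \<theta> where u: "u \<in> p" "is_union_below \<delta> \<eta> u" "dom u = {..<\<theta>}" "is_limit \<theta>"
      "\<forall>\<epsilon><\<delta>. len (\<eta> \<epsilon>) < \<theta> \<and> trunc u (len (\<eta> \<epsilon>)) = \<eta> \<epsilon>" "\<forall>\<beta><\<theta>. \<exists>\<epsilon><\<delta>. \<beta> \<le> len (\<eta> \<epsilon>)"
      using lim_case[OF inc _ lim] sp split_subset by blast
    have "dom u = fst ` Map.graph u" by (auto simp: Map.graph_def image_def)
    also have "\<dots> = (\<Union>\<epsilon><\<delta>. fst ` Map.graph (\<eta> \<epsilon>))" using u(2) by (auto simp: is_union_below_def)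
    also have "\<dots> = (\<Union>\<epsilon><\<delta>. dom (\<eta> \<epsilon>))" by (rule SUP_cong) (auto simp: Map.graph_def image_def)
    finally obtain \<theta>' where \<theta>': "\<theta>' \<in> W" "{..<\<theta>'} = dom u" using W by metis
    then have "\<theta>' = \<theta>" using u(3) by simp
    moreover have "len u = \<theta>" using u(3) by (rule len_eqI)
    ultimately have "u \<in> split p"
      using sc u \<theta>' sp unfolding split_closed_def by metis
    then show ?thesis using u by blast
  qed
  have "\<forall>\<eta>\<in>p. \<exists>\<nu>\<in>p. \<eta> \<subseteq>\<^sub>m \<nu> \<and> snoc \<nu> False \<in> p \<and> snoc \<nu> True \<in> p"
    using sd by (metis split_iff)
  then show "p \<in> sacks W"
    unfolding sacks_def by (intro CollectI conjI allI impI t) (use un sp in simp_all)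
qed

end

section \<open>Branches, chains and antichains of conditions\<close>

context regular_cardinal
begin

lemma split_at_divergence:
  fixes p :: "'a node set"
  assumes t: "is_tree p" and u: "u \<in> p" "\<xi> < len u" and v: "v \<in> p" "\<xi> < len v"
    and eq: "trunc u \<xi> = trunc v \<xi>" and neq: "u \<xi> \<noteq> v \<xi>"
  shows "trunc u \<xi> \<in> split p"
proof -
  have nd: "u \<in> nodes" "v \<in> nodes" using t u v tree_nodes by blast+
  obtain b c where b: "u \<xi> = Some b" and c: "v \<xi> = Some c"
    using u(2) v(2) node_None_iff[OF nd(1), of \<xi>] node_None_iff[OF nd(2), of \<xi>] by fastforce
  have "snoc (trunc u \<xi>) b \<in> p" using trunc_suc[OF nd(1) u(2) b] tree_trunc[OF t u(1)] by metis
  moreover have "snoc (trunc u \<xi>) c \<in> p"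
    using trunc_suc[OF nd(2) v(2) c] tree_trunc[OF t v(1)] eq by metis
  moreover have "b \<noteq> c" using neq b c by simp
  ultimately show ?thesis
    using tree_trunc[OF t u(1)] by (cases b; cases c) (auto simp: split_iff)
qed

lemma trunc_branch:
  assumes "dom (B :: 'a node) = UNIV"
  shows "trunc B \<alpha> \<in> nodes" "len (trunc B \<alpha>) = \<alpha>"
proof -
  have "dom (trunc B \<alpha>) = {..<\<alpha>}" unfolding dom_trunc assms by simp
  then show "trunc B \<alpha> \<in> nodes" "len (trunc B \<alpha>) = \<alpha>" by (rule nodesI, rule len_eqI)
qed

text \<open>
  Two incomparable nodes above \<open>\<eta>\<close> would split where they diverge, so the nodes above \<open>\<eta>\<close> form a chain. It
  contains nodes of every length, by extension at successors and by taking unions at limits.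
\<close>

lemma nonsplitting_branch:
  fixes X :: "'a node set"
  assumes t: "is_tree X" and lc: "limit_closed X" and ext: "\<And>u. u \<in> X \<Longrightarrow> \<exists>b. snoc u b \<in> X"
    and \<eta>: "\<eta> \<in> X" and nosplit: "\<And>u. u \<in> split X \<Longrightarrow> \<not> \<eta> \<subseteq>\<^sub>m u"
  obtains B where "dom B = UNIV" "\<And>\<alpha>. trunc B \<alpha> \<in> X" "\<And>u. u \<in> X \<Longrightarrow> \<eta> \<subseteq>\<^sub>m u \<Longrightarrow> u \<subseteq>\<^sub>m B"
proof -
  define Y where "Y = {u\<in>X. \<eta> \<subseteq>\<^sub>m u}"
  have nd: "\<And>u. u \<in> X \<Longrightarrow> u \<in> nodes" using t tree_nodes by blast
  have chain: "u \<subseteq>\<^sub>m v \<or> v \<subseteq>\<^sub>m u" if "u \<in> Y" "v \<in> Y" for u v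
  proof (rule ccontr)
    have uv: "u \<in> X" "v \<in> X" "\<eta> \<subseteq>\<^sub>m u" "\<eta> \<subseteq>\<^sub>m v" using that by (auto simp: Y_def)
    assume "\<not> (u \<subseteq>\<^sub>m v \<or> v \<subseteq>\<^sub>m u)"
    then obtain \<xi> where \<xi>: "\<xi> < len u" "\<xi> < len v" "trunc u \<xi> = trunc v \<xi>" "u \<xi> \<noteq> v \<xi>"
      using diverge[OF nd[OF uv(1)] nd[OF uv(2)]] by blast
    have "\<not> \<xi> < len \<eta>"
      using uv(3,4) \<xi>(4) dom_node[OF nd[OF \<eta>]] unfolding map_le_def by (metis lessThan_iff)
    then have "\<eta> \<subseteq>\<^sub>m trunc u \<xi>"
      using trunc_mono[of "len \<eta>" \<xi> u] map_le_eq_trunc[OF uv(3) nd[OF \<eta>]] by simp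
    moreover have "trunc u \<xi> \<in> split X" by (rule split_at_divergence[OF t uv(1) \<xi>(1) uv(2) \<xi>(2-4)])
    ultimately show False using nosplit by blast
  qed
  have ex: "\<exists>u\<in>Y. len u = \<alpha>" if "len \<eta> \<le> \<alpha>" for \<alpha>
    using that
  proof (induction \<alpha> rule: less_induct)
    case (less \<alpha>)
    show ?case
    proof (cases "len \<eta> = \<alpha>")
      case True
      then show ?thesis using \<eta> by (auto simp: Y_def)
    next
      case False
      then have lt: "len \<eta> < \<alpha>" using less.prems by simp
      show ?thesis
      proof (cases "is_limit \<alpha>")
        case False
        then show ?thesis
        proof (cases rule: not_limit_cases)
          case 1
          then show ?thesis using lt by blast
        next
          case (2 \<beta>)
          then obtain u where u: "u \<in> Y" "len u = \<beta>" using less.IH[of \<beta>] lt by auto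
          then obtain b where "snoc u b \<in> X" using ext by (auto simp: Y_def)
          moreover have "\<eta> \<subseteq>\<^sub>m snoc u b"
            using u nd map_le_snoc[of u b] by (auto simp: Y_def intro: map_le_trans)
          ultimately show ?thesis
            using len_snoc[of u b] u 2 nd by (intro bexI[of _ "snoc u b"]) (auto simp: Y_def)
        qed
      next
        case True
        define A where "A = {u\<in>Y. len u < \<alpha>}"
        define U where "U = union_of A"
        have chA: "u \<subseteq>\<^sub>m v \<or> v \<subseteq>\<^sub>m u" if "u \<in> A" "v \<in> A" for u v
          using chain that by (auto simp: A_def)
        have le: "u \<subseteq>\<^sub>m U" if "u \<in> A" for u
          unfolding U_def by (rule map_le_union_of[OF chA that])
        have "dom U = (\<Union>u\<in>A. {..<len u})"
          unfolding U_def dom_union_of using nd by (intro SUP_cong refl dom_node) (auto simp: A_def Y_def)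
        also have "\<dots> = {..<\<alpha>}"
        proof (intro equalityI subsetI)
          fix \<xi> assume "\<xi> \<in> {..<\<alpha>}"
          then have "max (suc \<xi>) (len \<eta>) < \<alpha>" using suc_less_limit[OF True] lt by simp
          then obtain u where "u \<in> Y" "len u = max (suc \<xi>) (len \<eta>)" using less.IH by fastforce
          moreover have "\<xi> < max (suc \<xi>) (len \<eta>)" by (simp add: less_max_iff_disj)
          ultimately show "\<xi> \<in> (\<Union>u\<in>A. {..<len u})"
            using \<open>max (suc \<xi>) (len \<eta>) < \<alpha>\<close> unfolding A_def by auto
        qed (auto simp: A_def)
        finally have dom: "dom U = {..<\<alpha>}" .
        have "trunc U \<beta> \<in> X" if "\<beta> < \<alpha>" for \<beta>
        proof -
          have "max \<beta> (len \<eta>) < \<alpha>" using lt \<open>\<beta> < \<alpha>\<close> by simp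
          then obtain u where u: "u \<in> Y" "len u = max \<beta> (len \<eta>)" using less.IH by fastforce
          then have uA: "u \<in> A" using lt \<open>\<beta> < \<alpha>\<close> by (simp add: A_def)
          then have "trunc U \<beta> = trunc u \<beta>"
            using map_le_eq_trunc[OF le[OF uA]] u nd trunc_trunc[of \<beta> "len u" U] by (simp add: Y_def)
          then show ?thesis using u tree_trunc[OF t] by (simp add: Y_def)
        qed
        then have "U \<in> X" using lc True dom unfolding limit_closed_def by blast
        moreover have "\<eta> \<subseteq>\<^sub>m U" by (rule le) (use \<eta> lt in \<open>simp add: A_def Y_def\<close>)
        ultimately show ?thesis using len_eqI[OF dom] by (intro bexI[of _ U]) (simp_all add: Y_def)
      qed
    qed
  qed
  define B where "B = union_of Y"
  have le: "u \<subseteq>\<^sub>m B" if "u \<in> Y" for u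
    unfolding B_def by (rule map_le_union_of[OF chain that])
  have "\<xi> \<in> dom B" for \<xi>
  proof -
    obtain u where u: "u \<in> Y" "len u = max (suc \<xi>) (len \<eta>)" using ex[of "max (suc \<xi>) (len \<eta>)"] by auto
    have "\<xi> \<in> dom u" using u nd dom_node[of u] by (auto simp: Y_def less_max_iff_disj)
    then show ?thesis unfolding B_def dom_union_of using u(1) by blast
  qed
  moreover have "trunc B \<alpha> \<in> X" for \<alpha>
  proof -
    obtain u where u: "u \<in> Y" "len u = max \<alpha> (len \<eta>)" using ex[of "max \<alpha> (len \<eta>)"] by auto
    then have "trunc B \<alpha> = trunc u \<alpha>"
      using map_le_eq_trunc[OF le[OF u(1)]] u nd trunc_trunc[of \<alpha> "len u" B] by (simp add: Y_def)
    then show ?thesis using u tree_trunc[OF t] by (simp add: Y_def)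
  qed
  ultimately show thesis using le by (intro that[of B]) (auto simp: Y_def)
qed

lemma sacksD:
  assumes "(p :: 'a node set) \<in> sacks W"
  shows "is_tree p" "limit_closed p" "split_closed W p" "\<And>\<eta>. \<eta> \<in> p \<Longrightarrow> \<exists>\<nu>\<in>split p. \<eta> \<subseteq>\<^sub>m \<nu>"
    "\<And>\<eta>. \<eta> \<in> p \<Longrightarrow> \<eta> \<in> nodes"
  using assms tree_nodes unfolding sacks_iff by blast+

lemma sacks_snoc:
  assumes "(p :: 'a node set) \<in> sacks W" "u \<in> p"
  shows "\<exists>b. snoc u b \<in> p"
proof -
  obtain \<nu> where \<nu>: "\<nu> \<in> split p" "u \<subseteq>\<^sub>m \<nu>" using sacksD(4)[OF assms] by blast
  have nd: "u \<in> nodes" "\<nu> \<in> nodes" using assms \<nu> split_subset sacksD(5) by blast+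
  show ?thesis
  proof (cases "len u < len \<nu>")
    case True
    then obtain b where b: "\<nu> (len u) = Some b" using node_None_iff[OF nd(2), of "len u"] by fastforce
    have "trunc \<nu> (len u) = u" using map_le_eq_trunc[OF \<nu>(2) nd(1)] by simp
    then have "snoc u b = trunc \<nu> (suc (len u))" using trunc_suc[OF nd(2) True b] by simp
    then show ?thesis using tree_trunc[OF sacksD(1)[OF assms(1)]] \<nu>(1) split_subset by (metis subsetD)
  next
    case False
    then have "u = \<nu>" using map_le_eq_trunc[OF \<nu>(2) nd(1)] trunc_all[OF nd(2)] by simp
    then show ?thesis using \<nu>(1) by (auto simp: split_iff)
  qed
qed

text \<open>
  If the branch did not split from level \<open>\<alpha>\<close> on, then all extensions of its node at \<open>\<alpha>\<close> would lie on it,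
  whereas some extension of that node splits.
\<close>

lemma branch_splits_unbounded:
  assumes p: "(p :: 'a node set) \<in> sacks W" and B: "dom B = UNIV" "\<And>\<alpha>. trunc B \<alpha> \<in> p"
  shows "\<exists>\<beta>\<ge>\<alpha>. trunc B \<beta> \<in> split p"
proof -
  obtain \<nu> where \<nu>: "\<nu> \<in> split p" "trunc B \<alpha> \<subseteq>\<^sub>m \<nu>" using sacksD(4)[OF p B(2)] by blast
  have nd: "\<nu> \<in> p" "\<nu> \<in> nodes" using p \<nu> split_subset sacksD(5) by blast+
  have len: "\<alpha> \<le> len \<nu>"
    using \<nu>(2) map_le_iff_node[OF trunc_branch(1)[OF B(1)] nd(2)] trunc_branch(2)[OF B(1)] by metis
  let ?v = "trunc B (len \<nu>)"
  have v: "?v \<in> nodes" "len ?v = len \<nu>" using trunc_branch[OF B(1)] by auto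
  show ?thesis
  proof (cases "\<nu> \<subseteq>\<^sub>m ?v \<or> ?v \<subseteq>\<^sub>m \<nu>")
    case True
    then have "\<nu> = ?v"
      using map_le_eq_trunc[OF _ v(1), of \<nu>] map_le_eq_trunc[OF _ nd(2), of ?v] v(2)
        trunc_all[OF nd(2)] trunc_all[OF v(1)] by (metis order.refl)
    then show ?thesis using \<nu>(1) len by metis
  next
    case False
    then obtain \<xi> where \<xi>: "\<xi> < len \<nu>" "trunc \<nu> \<xi> = trunc ?v \<xi>" "\<nu> \<xi> \<noteq> ?v \<xi>"
      using diverge[OF nd(2) v(1)] by blast
    have "\<alpha> \<le> \<xi>"
    proof (rule ccontr)
      assume "\<not> \<alpha> \<le> \<xi>"
      then have "\<xi> < \<alpha>" by simp
      then have "\<xi> \<in> dom (trunc B \<alpha>)" unfolding dom_trunc B(1) by simp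
      then have "\<nu> \<xi> = trunc B \<alpha> \<xi>" using \<nu>(2) unfolding map_le_def by metis
      then show False using \<open>\<xi> < \<alpha>\<close> \<xi> by (simp add: trunc_apply)
    qed
    moreover have "trunc \<nu> \<xi> \<in> split p"
      by (rule split_at_divergence[OF sacksD(1)[OF p] nd(1) \<xi>(1) B(2)[of "len \<nu>"] _ \<xi>(2,3)])
        (simp add: v(2) \<xi>(1))
    moreover have "trunc ?v \<xi> = trunc B \<xi>" using \<xi>(1) by (simp add: trunc_trunc)
    ultimately show ?thesis using \<xi>(2) by metis
  qed
qed

text \<open>
  The splitting nodes of the intersection have to be shown dense. If there were none above \<open>\<eta>\<close>, the
  intersection would contain a branch \<open>B\<close> through \<open>\<eta>\<close>. Every condition in the chain splits at unboundedly many
  levels of \<open>B\<close>, and since the chain is short, club many levels are limits of such levels for all of its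
  members at once. At one of these levels in \<open>W\<close> every member splits, and so does the intersection.
\<close>

lemma chain_Inter_sacks:
  assumes ne: "\<C> \<noteq> {}" and sub: "\<C> \<subseteq> sacks W" and small: "small \<C> \<kappa>"
    and chain: "\<And>p q. p \<in> \<C> \<Longrightarrow> q \<in> \<C> \<Longrightarrow> p \<subseteq> q \<or> q \<subseteq> p" and W: "stationary (W :: 'a set)"
  shows "\<Inter>\<C> \<in> sacks W"
proof -
  let ?X = "\<Inter>\<C>"
  have S: "\<And>p. p \<in> \<C> \<Longrightarrow> p \<in> sacks W" using sub by blast
  note D = sacksD[OF S]
  obtain p0 where p0: "p0 \<in> \<C>" using ne by blast
  have t: "is_tree ?X"
    unfolding is_tree_def
  proof (intro conjI ballI impI)
    show "?X \<noteq> {}" using tree_empty[OF D(1)] by blast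
    show "?X \<subseteq> nodes" using p0 D(5) by blast
    show "\<nu> \<in> ?X" if "\<eta> \<in> ?X" "\<nu> \<in> nodes" "\<nu> \<subseteq>\<^sub>m \<eta>" for \<eta> \<nu>
      using that tree_down[OF D(1)] by blast
  qed
  have lc: "limit_closed ?X" using D(2) unfolding limit_closed_def by blast
  have split_Inter: "u \<in> split ?X" if "\<And>p. p \<in> \<C> \<Longrightarrow> u \<in> split p" for u
    using that by (auto simp: split_iff)
  have sc: "split_closed W ?X"
    unfolding split_closed_def
  proof (intro ballI impI split_Inter)
    fix u p
    assume *: "u \<in> ?X" "len u \<in> W" "is_limit (len u)"
      "\<forall>\<alpha><len u. \<exists>\<beta><len u. \<alpha> \<le> \<beta> \<and> trunc u \<beta> \<in> split ?X" and p: "p \<in> \<C>"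
    have "split ?X \<subseteq> split p" using p by (intro split_mono) blast
    then show "u \<in> split p" using D(3)[OF p] * p unfolding split_closed_def by blast
  qed
  \<comment> \<open>If both successors of \<open>u\<close> were lost in the intersection, the smaller of two conditions losing them
    would have lost both.\<close>
  have ext: "\<exists>b. snoc u b \<in> ?X" if u: "u \<in> ?X" for u
  proof (rule ccontr)
    assume "\<not> ?thesis"
    then obtain p q where pq: "p \<in> \<C>" "snoc u False \<notin> p" "q \<in> \<C>" "snoc u True \<notin> q" by blast
    then obtain r where r: "r \<in> \<C>" "r \<subseteq> p" "r \<subseteq> q" using chain[OF pq(1,3)] by blast
    obtain b where "snoc u b \<in> r" using sacks_snoc[OF S[OF r(1)]] r(1) u by blast
    then show False using pq r by (cases b) auto
  qed
  have "\<exists>\<nu>\<in>split ?X. \<eta> \<subseteq>\<^sub>m \<nu>" if \<eta>: "\<eta> \<in> ?X" for \<eta>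
  proof (rule ccontr)
    assume no: "\<not> ?thesis"
    then have ns: "\<And>u. u \<in> split ?X \<Longrightarrow> \<not> \<eta> \<subseteq>\<^sub>m u" by blast
    obtain B where B: "dom B = UNIV" "\<And>\<alpha>. trunc B \<alpha> \<in> ?X"
      and "\<And>u. u \<in> ?X \<Longrightarrow> \<eta> \<subseteq>\<^sub>m u \<Longrightarrow> u \<subseteq>\<^sub>m B"
      using nonsplitting_branch[OF t lc ext \<eta> ns] by metis
    then have \<eta>B: "\<eta> \<subseteq>\<^sub>m B" using \<eta> map_le_refl by blast
    have "\<forall>p\<in>\<C>. \<forall>\<alpha>. \<exists>\<beta>\<ge>\<alpha>. trunc B \<beta> \<in> split p"
    proof (intro ballI allI)
      fix p \<alpha> assume "p \<in> \<C>"
      then show "\<exists>\<beta>\<ge>\<alpha>. trunc B \<beta> \<in> split p"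
        using B by (intro branch_splits_unbounded[OF S]) auto
    qed
    then obtain k where k: "\<And>p \<alpha>. p \<in> \<C> \<Longrightarrow> \<alpha> \<le> k p \<alpha> \<and> trunc B (k p \<alpha>) \<in> split p" by metis
    have "\<exists>\<beta>. \<forall>p\<in>\<C>. k p \<alpha> < \<beta>" for \<alpha> by (rule image_bounded[OF small])
    then obtain h where h: "\<And>\<alpha> p. p \<in> \<C> \<Longrightarrow> k p \<alpha> < h \<alpha>" by metis
    obtain \<delta> where \<delta>: "\<delta> \<in> W" "is_limit \<delta>" "\<And>\<alpha>. \<alpha> < \<delta> \<Longrightarrow> max (h \<alpha>) (len \<eta>) < \<delta>"
      using stationary_closure_point[OF W, of "\<lambda>\<alpha>. max (h \<alpha>) (len \<eta>)"] by blast
    let ?u = "trunc B \<delta>"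
    note u = trunc_branch[OF B(1), of \<delta>]
    have "?u \<in> split p" if p: "p \<in> \<C>" for p
    proof -
      have "\<exists>\<beta><\<delta>. \<alpha> \<le> \<beta> \<and> trunc ?u \<beta> \<in> split p" if "\<alpha> < \<delta>" for \<alpha>
      proof (intro exI conjI)
        show *: "k p \<alpha> < \<delta>" using h[OF p, of \<alpha>] \<delta>(3)[OF \<open>\<alpha> < \<delta>\<close>] by (auto intro: less_trans)
        show "\<alpha> \<le> k p \<alpha>" using k[OF p] by blast
        show "trunc ?u (k p \<alpha>) \<in> split p" using k[OF p] * by (simp add: trunc_trunc)
      qed
      then show ?thesis
        using D(3)[OF p] B(2)[of \<delta>] p u(2) \<delta>(1,2) unfolding split_closed_def by force
    qed
    then have "?u \<in> split ?X" by (rule split_Inter)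
    moreover have "\<eta> \<subseteq>\<^sub>m ?u"
    proof -
      have "len \<eta> \<le> \<delta>" using \<delta>(2,3) unfolding is_limit_def by fastforce
      then show ?thesis using trunc_mono[of "len \<eta>" \<delta> B] map_le_eq_trunc[OF \<eta>B] D(5)[OF p0] \<eta> p0 by auto
    qed
    ultimately show False using no by blast
  qed
  then show ?thesis unfolding sacks_iff using t lc sc by blast
qed

definition subtree :: "'a node set \<Rightarrow> 'a node \<Rightarrow> 'a node set" where
  "subtree p \<eta> = {\<nu>\<in>p. \<nu> \<subseteq>\<^sub>m \<eta> \<or> \<eta> \<subseteq>\<^sub>m \<nu>}"

lemma map_le_total:
  fixes u v w :: "'a node"
  assumes "u \<subseteq>\<^sub>m w" "v \<subseteq>\<^sub>m w" "u \<in> nodes" "v \<in> nodes"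
  shows "u \<subseteq>\<^sub>m v \<or> v \<subseteq>\<^sub>m u"
  using map_le_eq_trunc[OF assms(1,3)] map_le_eq_trunc[OF assms(2,4)] trunc_mono by (metis linear)

text \<open>
  Above \<open>\<eta>\<close> nothing changes, and a proper initial segment of \<open>\<eta>\<close> keeps only the successor towards \<open>\<eta>\<close>;
  hence the splitting nodes are exactly those of \<open>p\<close> that extend \<open>\<eta>\<close>.
\<close>

lemma subtree_sacks:
  assumes p: "p \<in> sacks W" and \<eta>: "\<eta> \<in> p"
  shows "subtree p \<eta> \<in> sacks W"
proof -
  let ?q = "subtree p \<eta>"
  note D = sacksD[OF p]
  note nd\<eta> = D(5)[OF \<eta>]
  have t: "is_tree ?q"
    unfolding is_tree_def
  proof (intro conjI ballI impI)
    show "?q \<noteq> {}" using \<eta> by (auto simp: subtree_def)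
    show "?q \<subseteq> nodes" using D(5) by (auto simp: subtree_def)
    fix u v assume *: "u \<in> ?q" "v \<in> nodes" "v \<subseteq>\<^sub>m u"
    then have "v \<in> p" using tree_down[OF D(1)] by (auto simp: subtree_def)
    moreover have "v \<subseteq>\<^sub>m \<eta> \<or> \<eta> \<subseteq>\<^sub>m v"
      using * map_le_total[OF *(3) _ *(2) nd\<eta>] map_le_trans by (auto simp: subtree_def)
    ultimately show "v \<in> ?q" by (simp add: subtree_def)
  qed
  have lc: "limit_closed ?q"
    unfolding limit_closed_def
  proof (intro allI impI)
    fix u \<theta> assume *: "is_limit \<theta>" "dom u = {..<\<theta>}" "\<forall>\<alpha><\<theta>. trunc u \<alpha> \<in> ?q"
    then have "u \<in> p" using D(2) unfolding limit_closed_def subtree_def by blast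
    moreover have "u \<subseteq>\<^sub>m \<eta> \<or> \<eta> \<subseteq>\<^sub>m u"
    proof (cases "\<exists>\<alpha><\<theta>. \<eta> \<subseteq>\<^sub>m trunc u \<alpha>")
      case True
      then show ?thesis using trunc_map_le map_le_trans by blast
    next
      case False
      have "u \<xi> = \<eta> \<xi>" if "\<xi> \<in> dom u" for \<xi>
      proof -
        have "\<xi> < \<theta>" using that *(2) by auto
        then obtain \<alpha> where \<alpha>: "\<xi> < \<alpha>" "\<alpha> < \<theta>" using *(1) unfolding is_limit_def by blast
        then have "trunc u \<alpha> \<subseteq>\<^sub>m \<eta>" using False *(3) by (auto simp: subtree_def)
        moreover have "\<xi> \<in> dom (trunc u \<alpha>)" using \<alpha> that by (simp add: dom_trunc)
        ultimately show ?thesis using \<alpha> by (metis map_le_def trunc_apply)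
      qed
      then show ?thesis by (simp add: map_le_def)
    qed
    ultimately show "u \<in> ?q" by (simp add: subtree_def)
  qed
  have splitI: "u \<in> split ?q" if "u \<in> split p" "\<eta> \<subseteq>\<^sub>m u" for u
    using that D(5) map_le_snoc[of u] map_le_trans unfolding split_iff subtree_def by blast
  have splitD: "u \<in> split p \<and> \<eta> \<subseteq>\<^sub>m u" if "u \<in> split ?q" for u
  proof
    show "u \<in> split p" using that split_mono[of ?q p] by (auto simp: subtree_def)
    then have u: "u \<in> nodes" using split_subset D(5) by blast
    show "\<eta> \<subseteq>\<^sub>m u"
    proof (rule ccontr)
      assume no: "\<not> \<eta> \<subseteq>\<^sub>m u"
      have "u \<subseteq>\<^sub>m \<eta>" using that no by (auto simp: split_iff subtree_def)
      then have lt: "len u < len \<eta>"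
        using no map_le_iff_node[OF u nd\<eta>] map_le_iff_node[OF nd\<eta> u] by (metis not_le antisym)
      have "snoc u b (len u) = \<eta> (len u)" if "snoc u b \<in> ?q" for b
      proof -
        have d: "len u \<in> dom (snoc u b)" "len u \<in> dom \<eta>"
          using lt by (simp_all add: dom_snoc[OF u] dom_node[OF nd\<eta>])
        from that have "snoc u b \<subseteq>\<^sub>m \<eta> \<or> \<eta> \<subseteq>\<^sub>m snoc u b" by (simp add: subtree_def)
        then show ?thesis using d unfolding map_le_def by metis
      qed
      then have "snoc u False (len u) = snoc u True (len u)" using that by (simp add: split_iff)
      then show False by (simp add: snoc_apply)
    qed
  qed
  have sc: "split_closed W ?q"
    unfolding split_closed_def
  proof (intro ballI impI)
    fix u assume *: "u \<in> ?q" "len u \<in> W" "is_limit (len u)"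
      "\<forall>\<alpha><len u. \<exists>\<beta><len u. \<alpha> \<le> \<beta> \<and> trunc u \<beta> \<in> split ?q"
    have "u \<in> split p" using D(3) * splitD unfolding split_closed_def subtree_def by blast
    moreover have "\<eta> \<subseteq>\<^sub>m u"
      using * splitD trunc_map_le map_le_trans unfolding is_limit_def by metis
    ultimately show "u \<in> split ?q" by (rule splitI)
  qed
  have "\<exists>\<nu>\<in>split ?q. u \<subseteq>\<^sub>m \<nu>" if u: "u \<in> ?q" for u
  proof -
    define v where "v = (if u \<subseteq>\<^sub>m \<eta> then \<eta> else u)"
    have v: "v \<in> p" "\<eta> \<subseteq>\<^sub>m v" "u \<subseteq>\<^sub>m v" using u \<eta> by (auto simp: v_def subtree_def)
    then show ?thesis using D(4)[OF v(1)] splitI map_le_trans by blast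
  qed
  then show ?thesis unfolding sacks_iff using t lc sc by blast
qed

text \<open>
  Removing the right successors of all splitting nodes of \<open>p\<close> leaves a tree that does not split at all and
  in which every node still has a successor.
\<close>

lemma leftmost_branch:
  assumes p: "(p :: 'a node set) \<in> sacks W"
  obtains B where "dom B = UNIV" "\<And>\<alpha>. trunc B \<alpha> \<in> p" "\<And>\<alpha>. trunc B \<alpha> \<in> split p \<Longrightarrow> B \<alpha> = Some False"
proof -
  note D = sacksD[OF p]
  define X where "X = {\<nu>\<in>p. \<forall>\<xi><len \<nu>. trunc \<nu> \<xi> \<in> split p \<longrightarrow> \<nu> \<xi> = Some False}"
  have Xp: "X \<subseteq> p" by (auto simp: X_def)
  have t: "is_tree X"
    unfolding is_tree_def
  proof (intro conjI ballI impI)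
    have "Map.empty \<in> X" using tree_empty[OF D(1)] dom_node[OF empty_node]
      by (auto simp: X_def)
    then show "X \<noteq> {}" by blast
    show "X \<subseteq> nodes" using D(5) Xp by blast
    fix u v assume *: "u \<in> X" "v \<in> nodes" "v \<subseteq>\<^sub>m u"
    then have u: "u \<in> nodes" using Xp D(5) by blast
    have 1: "v = trunc u (len v)" "len v \<le> len u"
      using map_le_eq_trunc[OF *(3,2)] map_le_iff_node[OF *(2) u] *(3) by auto
    have "v \<in> p" using tree_down[OF D(1)] * Xp by blast
    moreover have "v \<xi> = Some False" if "\<xi> < len v" "trunc v \<xi> \<in> split p" for \<xi>
    proof -
      have "trunc v \<xi> = trunc u \<xi>" using 1(1) that(1) trunc_trunc[of \<xi> "len v" u] by simp
      then have "u \<xi> = Some False" using * that 1(2) by (auto simp: X_def)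
      then show ?thesis using 1(1) that(1) by (metis trunc_apply)
    qed
    ultimately show "v \<in> X" by (simp add: X_def)
  qed
  have lc: "limit_closed X"
    unfolding limit_closed_def
  proof (intro allI impI)
    fix u \<theta> assume *: "is_limit \<theta>" "dom u = {..<\<theta>}" "\<forall>\<alpha><\<theta>. trunc u \<alpha> \<in> X"
    then have "u \<in> p" using D(2) Xp unfolding limit_closed_def by blast
    moreover have "u \<xi> = Some False" if "\<xi> < len u" "trunc u \<xi> \<in> split p" for \<xi>
    proof -
      have "\<xi> < \<theta>" using that len_eqI[OF *(2)] by simp
      then obtain \<alpha> where \<alpha>: "\<xi> < \<alpha>" "\<alpha> < \<theta>" using *(1) unfolding is_limit_def by blast
      have "dom (trunc u \<alpha>) = {..<\<alpha>}" unfolding dom_trunc *(2) using \<alpha> by auto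
      then have "len (trunc u \<alpha>) = \<alpha>" by (rule len_eqI)
      moreover have "trunc (trunc u \<alpha>) \<xi> = trunc u \<xi>" using \<alpha> by (simp add: trunc_trunc)
      ultimately have "trunc u \<alpha> \<xi> = Some False"
        using *(3) \<alpha> that by (auto simp: X_def)
      then show ?thesis using \<alpha> by (simp add: trunc_apply)
    qed
    ultimately show "u \<in> X" by (simp add: X_def)
  qed
  have snocX: "snoc u b \<in> X" if "u \<in> X" "snoc u b \<in> p" "u \<in> split p \<Longrightarrow> b = False" for u b
  proof -
    have u: "u \<in> nodes" using that(1) Xp D(5) by blast
    have "snoc u b \<xi> = Some False" if "\<xi> < len (snoc u b)" "trunc (snoc u b) \<xi> \<in> split p" for \<xi>
    proof -
      have le: "\<xi> \<le> len u" using that by (simp add: len_snoc[OF u])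
      have "trunc (snoc u b) \<xi> = trunc u \<xi>"
        using le by (intro ext) (auto simp: trunc_apply snoc_apply)
      then have 1: "trunc u \<xi> \<in> split p" using that(2) by simp
      show ?thesis
      proof (cases "\<xi> = len u")
        case True
        then show ?thesis using 1 trunc_all[OF u] \<open>u \<in> split p \<Longrightarrow> b = False\<close> by (simp add: snoc_apply)
      next
        case False
        then have "u \<xi> = Some False" using \<open>u \<in> X\<close> 1 le by (simp add: X_def)
        then show ?thesis using False by (simp add: snoc_apply)
      qed
    qed
    then show ?thesis using that(2) by (simp add: X_def)
  qed
  have ext: "\<exists>b. snoc u b \<in> X" if "u \<in> X" for u
  proof (cases "u \<in> split p")
    case True
    then show ?thesis using snocX[OF that, of False] by (auto simp: split_iff)
  next
    case False
    obtain b where "snoc u b \<in> p" using sacks_snoc[OF p] \<open>u \<in> X\<close> Xp by blast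
    then show ?thesis using snocX[OF that, of b] False by blast
  qed
  have nosplit: "u \<notin> split X" for u
  proof
    assume *: "u \<in> split X"
    then have "u \<in> split p" using split_mono[OF Xp] by blast
    have u: "u \<in> nodes" using * split_subset Xp D(5) by blast
    have "snoc u True \<in> X" using * by (simp add: split_iff)
    moreover have "trunc (snoc u True) (len u) = u"
      using map_le_eq_trunc[OF map_le_snoc[OF u] u] by metis
    ultimately have "snoc u True (len u) = Some False"
      using \<open>u \<in> split p\<close> len_snoc[OF u, of True] by (auto simp: X_def)
    then show False by (simp add: snoc_apply)
  qed
  obtain B where B: "dom B = UNIV" "\<And>\<alpha>. trunc B \<alpha> \<in> X"
    by (rule nonsplitting_branch[OF t lc ext tree_empty[OF t]]) (use nosplit in blast)+
  show thesis
  proof (rule that[OF B(1)])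
    show "trunc B \<alpha> \<in> p" for \<alpha> using B(2) Xp by blast
    show "B \<alpha> = Some False" if "trunc B \<alpha> \<in> split p" for \<alpha>
    proof -
      have "trunc (trunc B (suc \<alpha>)) \<alpha> = trunc B \<alpha>"
        by (rule trunc_trunc) (simp add: less_imp_le)
      then have "trunc B (suc \<alpha>) \<alpha> = Some False"
        using B(2)[of "suc \<alpha>"] that trunc_branch(2)[OF B(1)] by (simp add: X_def)
      then show ?thesis by (simp add: trunc_apply)
    qed
  qed
qed

text \<open>
  The nodes that leave the leftmost branch to the right at its splitting levels are pairwise incomparable,
  and there are \<open>\<kappa>\<close> of them.
\<close>

lemma sacks_antichain:
  assumes p: "(p :: 'a node set) \<in> sacks W" and Z: "|Z| \<le>o |UNIV :: 'a set|"
  obtains A where "\<And>s. s \<in> Z \<Longrightarrow> A s \<in> p"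
    "\<And>s s'. s \<in> Z \<Longrightarrow> s' \<in> Z \<Longrightarrow> s \<noteq> s' \<Longrightarrow> \<exists>\<xi>\<in>dom (A s) \<inter> dom (A s'). A s \<xi> \<noteq> A s' \<xi>"
proof -
  obtain B where B: "dom B = UNIV" "\<And>\<alpha>. trunc B \<alpha> \<in> p"
    "\<And>\<alpha>. trunc B \<alpha> \<in> split p \<Longrightarrow> B \<alpha> = Some False"
    by (rule leftmost_branch[OF p]) blast
  define K where "K = {\<alpha>. trunc B \<alpha> \<in> split p}"
  define A' where "A' \<alpha> = snoc (trunc B \<alpha>) True" for \<alpha>
  have A'_apply: "A' \<alpha> \<xi> = (if \<xi> = \<alpha> then Some True else trunc B \<alpha> \<xi>)" for \<alpha> \<xi>
    by (simp add: A'_def snoc_apply trunc_branch[OF B(1)])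
  have inc: "\<exists>\<xi>\<in>dom (A' \<alpha>) \<inter> dom (A' \<beta>). A' \<alpha> \<xi> \<noteq> A' \<beta> \<xi>" if "\<alpha> \<in> K" "\<beta> \<in> K" "\<alpha> < \<beta>" for \<alpha> \<beta>
    using that B(3)[of \<alpha>] by (intro bexI[of _ \<alpha>]) (auto simp: A'_apply trunc_apply K_def)
  have inc': "\<exists>\<xi>\<in>dom (A' \<alpha>) \<inter> dom (A' \<beta>). A' \<alpha> \<xi> \<noteq> A' \<beta> \<xi>" if "\<alpha> \<in> K" "\<beta> \<in> K" "\<alpha> \<noteq> \<beta>" for \<alpha> \<beta>
    using inc[of \<alpha> \<beta>] inc[of \<beta> \<alpha>] that by (cases \<alpha> \<beta> rule: linorder_cases) (auto simp: Int_commute eq_commute)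
  have "\<forall>\<alpha>. \<exists>\<beta>\<in>K. \<alpha> \<le> \<beta>" using branch_splits_unbounded[OF p B(1,2)] by (auto simp: K_def)
  then have "|UNIV :: 'a set| \<le>o |K|" by (rule unbounded_not_small)
  with Z have "|Z| \<le>o |K|" by (rule ordLeq_transitive)
  then obtain g where g: "inj_on g Z" "g ` Z \<subseteq> K" by (meson card_of_ordLeq)
  show thesis
  proof (rule that[of "A' \<circ> g"])
    show "(A' \<circ> g) s \<in> p" if "s \<in> Z" for s using g that by (auto simp: A'_def K_def split_iff)
    show "\<exists>\<xi>\<in>dom ((A' \<circ> g) s) \<inter> dom ((A' \<circ> g) s'). (A' \<circ> g) s \<xi> \<noteq> (A' \<circ> g) s' \<xi>"
      if "s \<in> Z" "s' \<in> Z" "s \<noteq> s'" for s s'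
      using inc'[of "g s" "g s'"] g that unfolding comp_def inj_on_def by blast
  qed
qed

lemma sacks_extend_node:
  assumes p: "(p :: 'a node set) \<in> sacks W" and \<eta>: "\<eta> \<in> p"
  obtains \<nu> where "\<nu> \<in> p" "\<eta> \<subseteq>\<^sub>m \<nu>" "\<alpha> \<le> len \<nu>"
proof -
  obtain B where B: "dom B = UNIV" "\<And>\<alpha>. trunc B \<alpha> \<in> subtree p \<eta>"
    by (rule leftmost_branch[OF subtree_sacks[OF p \<eta>]]) blast
  let ?\<nu> = "trunc B (max \<alpha> (len \<eta>))"
  note \<nu> = trunc_branch[OF B(1), of "max \<alpha> (len \<eta>)"]
  have nd: "\<eta> \<in> nodes" using sacksD(5)[OF p \<eta>] .
  have "?\<nu> \<in> p" "?\<nu> \<subseteq>\<^sub>m \<eta> \<or> \<eta> \<subseteq>\<^sub>m ?\<nu>" using B(2) by (auto simp: subtree_def)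
  moreover have "\<eta> \<subseteq>\<^sub>m ?\<nu>" if "?\<nu> \<subseteq>\<^sub>m \<eta>"
    using that map_le_eq_trunc[OF that \<nu>(1)] trunc_all[OF nd, of "len ?\<nu>"] \<nu>(2) by (metis map_le_refl max.cobounded2)
  ultimately show thesis using \<nu>(2) by (intro that[of ?\<nu>]) auto
qed

end

section \<open>Cardinal arithmetic and guessing\<close>

text \<open>
  A small set can be indexed by an ordinal below \<open>\<kappa>\<close>, so that functions on it become sequences of length
  less than \<open>\<kappa>\<close>.
\<close>

lemma small_bij_lessThan:
  fixes \<kappa> :: "'a::wellorder itself"
  assumes "small B \<kappa>"
  obtains f and a :: 'a where "bij_betw f B {..<a}"
proof -
  have F: "Field (ord_le :: 'a rel) = UNIV" by (auto simp: ord_le_def Field_def)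
  have wf: "wf ((ord_le :: 'a rel) - Id)"
    by (rule wf_subset[OF wf]) (auto simp: ord_le_def)
  have W: "Well_order (ord_le :: 'a rel)"
    unfolding well_order_on_def linear_order_on_def partial_order_on_def preorder_on_def F
    using wf by (auto simp: refl_on_def trans_def antisym_def total_on_def ord_le_def)
  then have "|UNIV :: 'a set| \<le>o (ord_le :: 'a rel)"
    using card_of_least[of UNIV ord_le] F by simp
  with assms have "|B| <o (ord_le :: 'a rel)" by (rule ordLess_ordLeq_trans)
  then obtain a where a: "|B| =o Restr (ord_le :: 'a rel) (underS ord_le a)"
    using ordLess_iff_ordIso_Restr[OF W card_of_Well_order] by blast
  have "underS (ord_le :: 'a rel) a = {..<a}" by (auto simp: underS_def ord_le_def)
  moreover have "Field (Restr (ord_le :: 'a rel) {..<a}) = {..<a}"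
    by (auto simp: Field_def ord_le_def)
  ultimately have "|B| =o |{..<a}|"
    using card_of_cong[OF a] by (simp add: Field_card_of)
  then show thesis using that unfolding card_of_ordIso[symmetric] by blast
qed

text \<open>
  Regularity is Koenig's argument: if \<open>B\<close> were small and unbounded, then from an enumeration
  \<open>\<langle>g \<alpha> : \<alpha> < \<kappa>\<rangle>\<close> of the sequences of length \<open>|B|\<close> one could diagonalise out of all \<open>g \<alpha>\<close> with
  \<open>\<alpha> \<le> b\<close> at the coordinate \<open>b \<in> B\<close>, and the resulting sequence would not be enumerated.
\<close>

lemma regular_cardinalI:
  assumes C: "Card_order (ord_le :: 'a::wellorder rel)" and unc: "cardSuc natLeq \<le>o (ord_le :: 'a rel)"
    and pow: "|seqs_below UNIV :: ('a \<rightharpoonup> 'a) set| \<le>o |UNIV :: 'a set|"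
  shows "regular_cardinal TYPE('a)"
proof
  have F: "Field (ord_le :: 'a rel) = UNIV" by (auto simp: ord_le_def Field_def)
  have iso: "|UNIV :: 'a set| =o (ord_le :: 'a rel)" using card_of_Field_ordIso[OF C] F by simp
  show lt: "|{..<\<alpha>}| <o |UNIV :: 'a set|" for \<alpha> :: 'a
  proof -
    have "underS (ord_le :: 'a rel) \<alpha> = {..<\<alpha>}" by (auto simp: underS_def ord_le_def)
    then show ?thesis
      using card_of_underS[OF C, of \<alpha>] F ordLess_ordIso_trans[OF _ ordIso_symmetric[OF iso]] by simp
  qed
  show nat: "|UNIV :: nat set| <o |UNIV :: 'a set|"
    using ordIso_ordLess_trans[OF card_of_nat cardSuc_greater[OF natLeq_Card_order]] unc
      ordIso_symmetric[OF iso] by (meson ordLess_ordLeq_trans ordLess_ordIso_trans)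
  have inf: "infinite (UNIV :: 'a set)"
    using nat by (metis card_of_ordLeq_infinite infinite_UNIV_nat ordLess_imp_ordLeq)
  fix B :: "'a set"
  assume B: "|B| <o |UNIV :: 'a set|"
  show "\<exists>\<alpha>. \<forall>b\<in>B. b < \<alpha>"
  proof (rule ccontr)
    assume "\<not> ?thesis"
    then have unb: "\<exists>b\<in>B. \<alpha> \<le> b" for \<alpha> by (meson not_less)
    obtain f and a :: 'a where f: "bij_betw f B {..<a}" by (rule small_bij_lessThan[OF B])
    obtain k :: "('a \<rightharpoonup> 'a) \<Rightarrow> 'a" where k: "inj_on k (seqs_below UNIV)"
      using pow by (metis card_of_ordLeq)
    define g where "g \<alpha> \<xi> = the (inv_into (seqs_below UNIV) k \<alpha> \<xi>)" for \<alpha> \<xi>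
    have "\<exists>x. x \<notin> (\<lambda>\<alpha>. g \<alpha> (f b)) ` {..b}" for b
    proof -
      have "|{b}| <o |UNIV :: 'a set|"
        by (intro finite_ordLess_infinite[OF card_of_Well_order card_of_Well_order])
          (simp_all add: Field_card_of inf)
      then have "|{..<b} \<union> {b}| <o |UNIV :: 'a set|"
        by (rule card_of_Un_ordLess_infinite[OF inf lt[of b]])
      moreover have "{..<b} \<union> {b} = {..b}" by auto
      ultimately have "|(\<lambda>\<alpha>. g \<alpha> (f b)) ` {..b}| <o |UNIV :: 'a set|"
        by (metis card_of_image ordLeq_ordLess_trans)
      then show ?thesis using ordLess_irreflexive by (metis UNIV_eq_I)
    qed
    then obtain h where h: "\<And>b \<alpha>. \<alpha> \<le> b \<Longrightarrow> h b \<noteq> g \<alpha> (f b)"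
      by (metis atMost_iff image_eqI)
    define t where "t \<xi> = (if \<xi> < a then Some (h (inv_into B f \<xi>)) else None)" for \<xi>
    have t: "t \<in> seqs_below UNIV"
      unfolding seqs_below_def by (auto simp: t_def dom_def)
    obtain b where b: "b \<in> B" "k t \<le> b" using unb by blast
    have "f b < a" using f b(1) by (auto simp: bij_betw_def)
    then have "t (f b) = Some (h b)" using f b(1) by (simp add: t_def bij_betw_def)
    moreover have "g (k t) (f b) = the (t (f b))"
      unfolding g_def using k t by simp
    ultimately show False using h[OF b(2)] by simp
  qed
qed

text \<open>
  Enumerate \<open>U\<close>, with repetitions, in order type \<open>\<kappa>\<close> and choose for the \<open>\<alpha>\<close>-th member \<open>u\<close> some
  \<open>f \<in> FF\<close> such that \<open>E u f\<close> differs from the fewer than \<open>\<kappa>\<close> points chosen before; it exists because \<open>E u\<close> takes at least \<open>\<kappa>\<close> values. The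
  function \<open>F\<close> is then prescribed at pairwise different points.
\<close>

lemma diagonal_guess:
  fixes E :: "'u \<Rightarrow> 'f \<Rightarrow> 'z" and X :: "'u \<Rightarrow> 'f \<Rightarrow> 'w" and \<kappa> :: "'a::wellorder itself"
  assumes lt: "\<And>\<alpha>::'a. small {..<\<alpha>} \<kappa>" and FF: "|UNIV :: 'a set| \<le>o |FF|" and U: "|U| \<le>o |UNIV :: 'a set|"
    and inj: "\<And>u. u \<in> U \<Longrightarrow> inj_on (E u) FF"
  obtains F where "\<And>u. u \<in> U \<Longrightarrow> \<exists>f\<in>FF. F (E u f) = X u f"
proof (cases "U = {}")
  case False
  then have "\<exists>u :: 'a \<Rightarrow> 'u. range u = U"
    using U card_of_ordLeq2[of U "UNIV :: 'a set"] by simp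
  then obtain u :: "'a \<Rightarrow> 'u" where u: "range u = U" by blast
  have "\<exists>\<rho>. \<forall>\<alpha>::'a. \<rho> \<alpha> \<in> FF \<and> E (u \<alpha>) (\<rho> \<alpha>) \<notin> (\<lambda>\<beta>. E (u \<beta>) (\<rho> \<beta>)) ` {..<\<alpha>}"
  proof (rule dependent_wf_choice[of "{(x, y). x < y}"])
    show "wf {(x, y::'a). x < y}" by (rule wf)
    show "(r \<in> FF \<and> E (u x) r \<notin> (\<lambda>\<beta>. E (u \<beta>) (f \<beta>)) ` {..<x}) =
      (r \<in> FF \<and> E (u x) r \<notin> (\<lambda>\<beta>. E (u \<beta>) (g \<beta>)) ` {..<x})"
      if "\<And>z. (z, x) \<in> {(x, y). x < y} \<Longrightarrow> f z = g z" for f g r and x :: 'a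
    proof -
      have "(\<lambda>\<beta>. E (u \<beta>) (f \<beta>)) ` {..<x} = (\<lambda>\<beta>. E (u \<beta>) (g \<beta>)) ` {..<x}"
        using that by (intro image_cong) auto
      then show ?thesis by simp
    qed
    show "\<exists>r. r \<in> FF \<and> E (u x) r \<notin> (\<lambda>\<beta>. E (u \<beta>) (f \<beta>)) ` {..<x}" for x :: 'a and f
    proof (rule ccontr)
      assume "\<not> ?thesis"
      then have "E (u x) ` FF \<subseteq> (\<lambda>\<beta>. E (u \<beta>) (f \<beta>)) ` {..<x}" by blast
      then have "|E (u x) ` FF| \<le>o |{..<x}|"
        by (meson card_of_image card_of_mono1 ordLeq_transitive)
      moreover have "inj_on (E (u x)) FF" using inj u by blast
      then have "|FF| \<le>o |E (u x) ` FF|"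
        by (meson card_of_ordIsoI inj_on_imp_bij_betw ordIso_iff_ordLeq)
      ultimately have "|UNIV :: 'a set| \<le>o |{..<x}|"
        using FF by (meson ordLeq_transitive)
      then show False using lt[of x] not_ordLess_ordLeq by blast
    qed
  qed
  then obtain \<rho> where \<rho>: "\<And>\<alpha>. \<rho> \<alpha> \<in> FF" "\<And>\<alpha> \<beta>. \<beta> < \<alpha> \<Longrightarrow> E (u \<alpha>) (\<rho> \<alpha>) \<noteq> E (u \<beta>) (\<rho> \<beta>)"
    by fastforce
  have inj\<rho>: "\<alpha> = \<beta>" if "E (u \<alpha>) (\<rho> \<alpha>) = E (u \<beta>) (\<rho> \<beta>)" for \<alpha> \<beta>
    using \<rho>(2)[of \<alpha> \<beta>] \<rho>(2)[of \<beta> \<alpha>] that by (cases \<alpha> \<beta> rule: linorder_cases) auto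
  define F where "F z = (let \<alpha> = SOME \<alpha>. E (u \<alpha>) (\<rho> \<alpha>) = z in X (u \<alpha>) (\<rho> \<alpha>))" for z
  have F: "F (E (u \<alpha>) (\<rho> \<alpha>)) = X (u \<alpha>) (\<rho> \<alpha>)" for \<alpha>
  proof -
    have "(SOME \<beta>. E (u \<beta>) (\<rho> \<beta>) = E (u \<alpha>) (\<rho> \<alpha>)) = \<alpha>"
      by (rule some_equality) (auto dest: inj\<rho>)
    then show ?thesis by (simp add: F_def)
  qed
  show thesis
  proof (rule that)
    fix v assume "v \<in> U"
    then obtain \<alpha> where "v = u \<alpha>" using u by blast
    then show "\<exists>f\<in>FF. F (E v f) = X v f" using F \<rho>(1) by blast
  qed
qed (use that in blast)

lemma card_Func_small:
  fixes \<kappa> :: "'a::wellorder itself"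
  assumes Z: "small Z \<kappa>" and N: "|N| \<le>o |UNIV :: 'a set|"
    and pow: "|seqs_below UNIV :: ('a \<rightharpoonup> 'a) set| \<le>o |UNIV :: 'a set|"
  shows "|Func Z N| \<le>o |UNIV :: 'a set|"
proof -
  obtain f and a :: 'a where f: "bij_betw f Z {..<a}" by (rule small_bij_lessThan[OF Z])
  obtain n :: "_ \<Rightarrow> 'a" where n: "inj_on n N" using N by (metis card_of_ordLeq)
  define g where "g u = (\<lambda>\<xi>. if \<xi> < a then Some (n (u (inv_into Z f \<xi>))) else None)" for u
  have "g ` Func Z N \<subseteq> seqs_below UNIV"
    unfolding seqs_below_def g_def by (auto simp: dom_def)
  moreover have "inj_on g (Func Z N)"
  proof (rule inj_onI)
    fix u v assume u: "u \<in> Func Z N" and v: "v \<in> Func Z N" and eq: "g u = g v"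
    show "u = v"
    proof
      fix z
      show "u z = v z"
      proof (cases "z \<in> Z")
        case True
        then have "f z < a" "inv_into Z f (f z) = z" using f by (auto simp: bij_betw_def)
        then have "n (u z) = n (v z)" using fun_cong[OF eq, of "f z"] by (simp add: g_def)
        then show ?thesis using n u v True unfolding inj_on_def Func_def by blast
      next
        case False
        then show ?thesis using u v by (simp add: Func_def)
      qed
    qed
  qed
  ultimately have "|Func Z N| \<le>o |seqs_below UNIV :: ('a \<rightharpoonup> 'a) set|" by (metis card_of_ordLeq)
  then show ?thesis using pow by (rule ordLeq_transitive)
qed

text \<open>
  \<open>code f \<nu>\<close> is \<open>f \<restriction> \<nu>\<close> as a node, and \<open>glue \<sigma> t f\<close> is the branch given by \<open>f\<close> in the tree of nodes
  \<open>t\<close>, which is indexed by the binary sequences shorter than \<open>\<sigma>\<close>.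
\<close>

definition code :: "('a::wellorder \<Rightarrow> bool) \<Rightarrow> 'a \<Rightarrow> 'a node" where
  "code f \<nu> = (\<lambda>\<xi>. if \<xi> < \<nu> then Some (f \<xi>) else None)"

definition glue :: "'a::wellorder \<Rightarrow> ('a node \<Rightarrow> 'a node) \<Rightarrow> ('a \<Rightarrow> bool) \<Rightarrow> 'a node" where
  "glue \<sigma> t f = union_of {t (code f \<nu>) |\<nu>. \<nu> < \<sigma>}"

lemma dom_code: "dom (code f \<nu>) = {..<\<nu>}"
  by (auto simp: code_def dom_def)

lemma code_seqs: "\<nu> < \<sigma> \<Longrightarrow> code f \<nu> \<in> seqs_below {..<\<sigma>}"
  using dom_code unfolding seqs_below_def by blast

lemma code_eq_iff: "code f \<nu> = code g \<nu> \<longleftrightarrow> (\<forall>\<xi><\<nu>. f \<xi> = g \<xi>)"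
  by (auto simp: code_def fun_eq_iff)

context regular_cardinal
begin

lemma card_nodes:
  assumes pow: "|seqs_below UNIV :: ('a \<rightharpoonup> 'a) set| \<le>o |UNIV :: 'a set|"
  shows "|nodes :: 'a node set| \<le>o |UNIV :: 'a set|"
proof -
  obtain c0 c1 :: 'a where "c0 < c1" using ex_greater by blast
  then have c: "c0 \<noteq> c1" by simp
  define g :: "'a node \<Rightarrow> ('a \<rightharpoonup> 'a)" where "g u = (\<lambda>\<xi>. map_option (\<lambda>b. if b then c1 else c0) (u \<xi>))" for u
  have "dom (g u) = dom u" for u by (auto simp: g_def dom_def)
  then have "g ` nodes \<subseteq> seqs_below UNIV" unfolding seqs_below_def by auto
  moreover have "inj_on g nodes"
  proof (rule inj_onI, rule ext)
    fix u v \<xi> assume "g u = g v"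
    then have "g u \<xi> = g v \<xi>" by simp
    then show "u \<xi> = v \<xi>" using c by (cases "u \<xi>"; cases "v \<xi>") (auto simp: g_def split: if_splits)
  qed
  ultimately have "|nodes :: 'a node set| \<le>o |seqs_below UNIV :: ('a \<rightharpoonup> 'a) set|" by (metis card_of_ordLeq)
  then show ?thesis using pow by (rule ordLeq_transitive)
qed

text \<open>
  Only the values of \<open>t\<close> and \<open>y\<close> on the small set of binary sequences shorter than \<open>\<sigma>\<close> enter, so by
  \<open>\<kappa>\<^bsup><\<kappa>\<^esup> = \<kappa>\<close> there are at most \<open>\<kappa>\<close> different pairs to guess.
\<close>

lemma guessing_function:
  fixes \<sigma> :: 'a
  assumes pow: "|seqs_below UNIV :: ('a \<rightharpoonup> 'a) set| \<le>o |UNIV :: 'a set|"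
    and Z: "small (seqs_below {..<\<sigma>} :: 'a node set) \<kappa>"
    and FF: "|UNIV :: 'a set| \<le>o |Func {..<\<sigma>} (UNIV :: bool set)|"
  obtains F :: "'a node \<Rightarrow> 'a node" where
    "\<And>t y. (\<And>s. t s \<in> nodes) \<Longrightarrow> (\<And>s. y s \<in> nodes) \<Longrightarrow> inj_on (glue \<sigma> t) (Func {..<\<sigma>} UNIV) \<Longrightarrow>
       \<exists>f\<in>Func {..<\<sigma>} UNIV. F (glue \<sigma> t f) = glue \<sigma> y f"
proof -
  let ?Z = "seqs_below {..<\<sigma>} :: 'a node set" and ?F = "Func {..<\<sigma>} (UNIV :: bool set)"
  let ?N = "nodes \<times> nodes :: ('a node \<times> 'a node) set"
  let ?U = "{u \<in> Func ?Z ?N. inj_on (glue \<sigma> (fst \<circ> u)) ?F}"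
  have "|?N| \<le>o |(UNIV :: 'a set) \<times> (UNIV :: 'a set)|"
    by (rule ordLeq_transitive[OF card_of_Times_mono1 card_of_Times_mono2]) (rule card_nodes[OF pow])+
  then have "|?N| \<le>o |UNIV :: 'a set|"
    using card_of_Times_same_infinite[OF infinite_ordinals] by (rule ordLeq_ordIso_trans)
  then have "|Func ?Z ?N| \<le>o |UNIV :: 'a set|" by (intro card_Func_small[OF Z _ pow])
  moreover have "|?U| \<le>o |Func ?Z ?N|" by (rule card_of_mono1) blast
  ultimately have U: "|?U| \<le>o |UNIV :: 'a set|" using ordLeq_transitive by blast
  obtain F where F: "\<And>u. u \<in> ?U \<Longrightarrow> \<exists>f\<in>?F. F (glue \<sigma> (fst \<circ> u) f) = glue \<sigma> (snd \<circ> u) f"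
    by (rule diagonal_guess[OF small_lessThan FF U, of "\<lambda>u. glue \<sigma> (fst \<circ> u)" "\<lambda>u. glue \<sigma> (snd \<circ> u)"]) blast+
  show thesis
  proof (rule that)
    fix t y :: "'a node \<Rightarrow> 'a node"
    assume t: "\<And>s. t s \<in> nodes" and y: "\<And>s. y s \<in> nodes" and inj: "inj_on (glue \<sigma> t) ?F"
    define u where "u s = (if s \<in> ?Z then (t s, y s) else undefined)" for s
    have "{(fst \<circ> u) (code f \<nu>) |\<nu>. \<nu> < \<sigma>} = {t (code f \<nu>) |\<nu>. \<nu> < \<sigma>}"
      "{(snd \<circ> u) (code f \<nu>) |\<nu>. \<nu> < \<sigma>} = {y (code f \<nu>) |\<nu>. \<nu> < \<sigma>}" for f
      using code_seqs[of _ \<sigma> f] by (auto simp: u_def)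
    then have g: "glue \<sigma> (fst \<circ> u) = glue \<sigma> t" "glue \<sigma> (snd \<circ> u) = glue \<sigma> y"
      by (auto simp: glue_def fun_eq_iff)
    have "u \<in> Func ?Z ?N" using t y by (auto simp: Func_def u_def)
    then have "u \<in> ?U" using inj g by simp
    then show "\<exists>f\<in>?F. F (glue \<sigma> t f) = glue \<sigma> y f" using F[of u] g by simp
  qed
qed

end

lemma ord_le_Restr_iso:
  fixes A B :: "'a::wellorder set"
  assumes "Restr ord_le A =o Restr ord_le B"
  obtains \<phi> where "bij_betw \<phi> A B" "\<And>\<beta> \<gamma>. \<beta> \<in> A \<Longrightarrow> \<gamma> \<in> A \<Longrightarrow> \<gamma> < \<beta> \<Longrightarrow> \<phi> \<gamma> < \<phi> \<beta>"
proof -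
  have F: "Field (Restr ord_le A) = A" for A :: "'a set" by (auto simp: Field_def ord_le_def)
  obtain \<phi> where "iso (Restr ord_le A) (Restr ord_le B) \<phi>"
    using assms unfolding ordIso_def by auto
  then have bij: "bij_betw \<phi> A B" and ord: "\<And>a b. a \<in> A \<Longrightarrow> b \<in> A \<Longrightarrow> a \<le> b \<longleftrightarrow> \<phi> a \<le> \<phi> b"
    unfolding iso_iff2 F by (auto simp: ord_le_def bij_betw_def)
  show thesis
  proof (rule that[OF bij])
    show "\<phi> \<gamma> < \<phi> \<beta>" if "\<beta> \<in> A" "\<gamma> \<in> A" "\<gamma> < \<beta>" for \<beta> \<gamma>
      using ord[of \<beta> \<gamma>] that by (meson not_le)
  qed
qed

lemma cf_cofinal:
  assumes "Card_order (ord_le :: 'a rel)"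
  obtains H where "cofinal_in {..<\<alpha>::'a::wellorder} H" "has_otp H (cf \<alpha>)"
proof -
  have "Well_order (Restr (ord_le :: 'a rel) {..<\<alpha>})"
    using assms by (intro Well_order_Restr) (simp add: card_order_on_well_order_on)
  then have "has_otp {..<\<alpha>} \<alpha>" unfolding has_otp_def by (rule ordIso_reflexive)
  moreover have "cofinal_in {..<\<alpha>} {..<\<alpha>}" by (auto simp: cofinal_in_def)
  ultimately have "\<exists>\<beta> C. cofinal_in {..<\<alpha>} C \<and> has_otp C \<beta>" by blast
  then have "\<exists>C. cofinal_in {..<\<alpha>} C \<and> has_otp C (cf \<alpha>)" unfolding cf_def by (rule LeastI_ex)
  then show thesis using that by blast
qed

lemma infinite_Card_order_limit:
  fixes \<sigma> :: "'a::wellorder"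
  assumes C: "Card_order (Restr ord_le {..<\<sigma>})" and inf: "infinite {..<\<sigma>}"
  shows "is_limit \<sigma>"
proof -
  have F: "Field (Restr ord_le {..<\<sigma>}) = {..<\<sigma>}" by (auto simp: Field_def ord_le_def)
  have "\<exists>\<gamma><\<sigma>. \<beta> < \<gamma>" if "\<beta> < \<sigma>" for \<beta>
  proof (rule ccontr)
    assume "\<not> ?thesis"
    then have "Field (Restr ord_le {..<\<sigma>}) = under (Restr ord_le {..<\<sigma>}) \<beta>"
      unfolding F using \<open>\<beta> < \<sigma>\<close> by (auto simp: under_def ord_le_def)
    then show False using Card_order_infinite_not_under[OF C] inf F by auto
  qed
  moreover have "\<exists>\<beta>. \<beta> < \<sigma>" using inf by (metis finite.emptyI lessThan_iff equals0I)
  ultimately show ?thesis unfolding is_limit_def by blast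
qed

section \<open>Descending sequences and the forcing relation\<close>

text \<open>
  At stage \<open>\<gamma>\<close> the operation \<open>st \<gamma>\<close> is applied to the intersection of everything obtained before. When
  \<open>st\<close> strengthens conditions this is a decreasing sequence, and its \<open>\<beta>\<close>-th member depends on the
  operations below \<open>\<beta>\<close> only.
\<close>

function descend :: "('a::wellorder \<Rightarrow> 'n set \<Rightarrow> 'n set) \<Rightarrow> 'n set \<Rightarrow> 'a \<Rightarrow> 'n set" where
  "descend st p \<beta> = p \<inter> (\<Inter>\<gamma>\<in>{..<\<beta>}. st \<gamma> (descend st p \<gamma>))"
  by auto
termination
  by (relation "inv_image {(x, y). x < y} (\<lambda>(st, p, \<beta>). \<beta>)") (auto simp: wellorder_class.wf)

declare descend.simps [simp del]

lemma descend_subset: "descend st p \<beta> \<subseteq> p"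
  by (subst descend.simps) blast

lemma descend_step: "\<gamma> < \<beta> \<Longrightarrow> descend st p \<beta> \<subseteq> st \<gamma> (descend st p \<gamma>)"
  by (subst descend.simps) blast

lemma descend_cong:
  "(\<And>\<gamma>. \<gamma> < \<beta> \<Longrightarrow> st \<gamma> = st' \<gamma>) \<Longrightarrow> descend st p \<beta> = descend st' p \<beta>"
proof (induction \<beta> rule: less_induct)
  case (less \<beta>)
  then have "descend st p \<gamma> = descend st' p \<gamma>" if "\<gamma> < \<beta>" for \<gamma>
    using that by (meson less_trans)
  then have "(\<Inter>\<gamma>\<in>{..<\<beta>}. st \<gamma> (descend st p \<gamma>)) = (\<Inter>\<gamma>\<in>{..<\<beta>}. st' \<gamma> (descend st' p \<gamma>))"
    using less.prems by (intro INF_cong) auto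
  then show ?case by (subst (1 2) descend.simps) simp
qed

locale sacks_forcing = regular_cardinal \<kappa> for \<kappa> :: "'a::wellorder itself" +
  fixes W :: "'a set"
  assumes stationary_W: "stationary W"

sublocale sacks_forcing \<subseteq> forcing "sacks W" sacks_le .

context sacks_forcing
begin

lemma descend_sacks:
  fixes st :: "'a \<Rightarrow> 'a node set \<Rightarrow> 'a node set" and \<beta> :: 'a
  assumes p: "p \<in> sacks W"
    and st: "\<And>\<gamma> q. q \<in> sacks W \<Longrightarrow> q \<subseteq> p \<Longrightarrow> st \<gamma> q \<in> sacks W \<and> st \<gamma> q \<subseteq> q"
  shows "descend st p \<beta> \<in> sacks W"
proof (induction \<beta> rule: less_induct)
  case (less \<beta>)
  let ?s = "\<lambda>\<gamma>. st \<gamma> (descend st p \<gamma>)"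
  let ?C = "insert p (?s ` {..<\<beta>})"
  have s: "?s \<gamma> \<in> sacks W" "?s \<gamma> \<subseteq> descend st p \<gamma>" if "\<gamma> < \<beta>" for \<gamma>
    using st[OF less.IH[OF that] descend_subset] by auto
  have le: "?s \<zeta> \<subseteq> ?s \<gamma>" if "\<gamma> < \<zeta>" "\<zeta> < \<beta>" for \<gamma> \<zeta>
    using s(2)[OF that(2)] descend_step[OF that(1), of st p] by (rule subset_trans)
  have sp: "?s \<gamma> \<subseteq> p" if "\<gamma> < \<beta>" for \<gamma>
    using s(2)[OF that] descend_subset[of st p \<gamma>] by (rule subset_trans)
  have "\<Inter>?C \<in> sacks W"
  proof (rule chain_Inter_sacks[OF _ _ _ _ stationary_W])
    have "|{p}| <o |UNIV :: 'a set|" by (rule small_finite) simp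
    then have "small ({p} \<union> ?s ` {..<\<beta>}) \<kappa>"
      using small_image[OF small_lessThan, of ?s \<beta>] by (intro card_of_Un_ordLess_infinite infinite_ordinals)
    then show "small ?C \<kappa>" by simp
    show "q \<subseteq> r \<or> r \<subseteq> q" if "q \<in> ?C" "r \<in> ?C" for q r
    proof -
      consider "q = p" | "r = p" | \<gamma> \<zeta> where "q = ?s \<gamma>" "r = ?s \<zeta>" "\<gamma> < \<beta>" "\<zeta> < \<beta>"
        using \<open>q \<in> ?C\<close> \<open>r \<in> ?C\<close> by blast
      then show ?thesis
      proof cases
        case 1
        then show ?thesis using \<open>r \<in> ?C\<close> sp by blast
      next
        case 2
        then show ?thesis using \<open>q \<in> ?C\<close> sp by blast
      next
        case (3 \<gamma> \<zeta>)
        then show ?thesis using le[of \<gamma> \<zeta>] le[of \<zeta> \<gamma>] by (cases \<gamma> \<zeta> rule: linorder_cases) auto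
      qed
    qed
  qed (use p s in auto)
  then show ?case by (subst descend.simps) simp
qed

lemma forces_mem_mono: "forces_mem b \<tau> p \<Longrightarrow> q \<subseteq> p \<Longrightarrow> forces_mem b \<tau> q"
  unfolding forces_mem_def sacks_le_def by (meson subset_trans)

lemma forces_not_mono: "forces_not \<phi> p \<Longrightarrow> q \<subseteq> p \<Longrightarrow> forces_not \<phi> q"
  unfolding forces_not_def sacks_le_def by (meson subset_trans)

lemma decided_mono:
  "forces_mem b \<tau> p \<or> forces_not (forces_mem b \<tau>) p \<Longrightarrow> q \<subseteq> p \<Longrightarrow>
    forces_mem b \<tau> q \<or> forces_not (forces_mem b \<tau>) q"
  using forces_mem_mono forces_not_mono by metis

lemma forces_notD: "forces_not \<phi> p \<Longrightarrow> p \<in> sacks W \<Longrightarrow> \<not> \<phi> p"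
  unfolding forces_not_def sacks_le_def by blast

lemma forces_impI:
  assumes "\<And>q. q \<in> sacks W \<Longrightarrow> q \<subseteq> p \<Longrightarrow> \<phi> q \<Longrightarrow> \<psi> q"
  shows "forces_imp \<phi> \<psi> p"
  unfolding forces_imp_def forces_not_def[of "forces_and \<phi> (forces_not \<psi>)"]
proof (intro ballI impI notI)
  fix q assume q: "q \<in> sacks W" "sacks_le p q" and "forces_and \<phi> (forces_not \<psi>) q"
  then have "\<psi> q" "forces_not \<psi> q" using assms by (auto simp: forces_and_def sacks_le_def)
  then show False using forces_notD q(1) by blast
qed

lemma forces_bexI:
  assumes "\<And>q. q \<in> sacks W \<Longrightarrow> q \<subseteq> p \<Longrightarrow> \<exists>r\<in>sacks W. r \<subseteq> q \<and> (\<exists>b\<in>B. \<Phi> b r)"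
  shows "forces_bex B \<Phi> p"
  unfolding forces_bex_def forces_not_def[of "forces_ball B _"]
proof (intro ballI impI notI)
  fix q assume q: "q \<in> sacks W" "sacks_le p q" and no: "forces_ball B (\<lambda>b. forces_not (\<Phi> b)) q"
  then obtain r b where r: "r \<in> sacks W" "r \<subseteq> q" "b \<in> B" "\<Phi> b r"
    using assms[of q] by (auto simp: sacks_le_def)
  then have "forces_not (\<Phi> b) q" using no by (simp add: forces_ball_def)
  then show False using r by (simp add: forces_not_def sacks_le_def)
qed

lemma forces_ex_nameI:
  assumes d: "d \<subseteq> UNIV \<times> sacks W" and \<Phi>: "\<And>q. q \<in> sacks W \<Longrightarrow> \<Phi> d q"
  shows "forces_ex_name \<Phi> p"
  unfolding forces_ex_name_def forces_not_def[of "forces_all_names _"]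
proof (intro ballI impI notI)
  fix q assume q: "q \<in> sacks W" "forces_all_names (\<lambda>\<tau>. forces_not (\<Phi> \<tau>)) q"
  then have "forces_not (\<Phi> d) q" using d by (simp add: forces_all_names_def)
  then show False using forces_notD[OF _ q(1)] \<Phi>[OF q(1)] by blast
qed

lemma forces_club_mono: "forces_club C p \<Longrightarrow> q \<subseteq> p \<Longrightarrow> forces_club C q"
  unfolding forces_club_def forces_and_def forces_ball_def forces_bex_def forces_imp_def
  using forces_not_mono by blast

lemma forces_club_unbounded:
  assumes "forces_club C p" "p \<in> sacks W"
  shows "\<exists>q\<in>sacks W. q \<subseteq> p \<and> (\<exists>\<gamma>\<ge>\<beta>. forces_mem \<gamma> C q)"
proof -
  have "forces_bex {\<beta>..} (\<lambda>\<gamma>. forces_mem \<gamma> C) p"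
    using assms(1) unfolding forces_club_def forces_and_def forces_ball_def by blast
  then show ?thesis
    using assms(2) unfolding forces_bex_def forces_not_def forces_ball_def sacks_le_def by fastforce
qed

lemma forces_club_closed:
  assumes C: "forces_club C p" "p \<in> sacks W" and \<delta>: "is_limit \<delta>"
    and cof: "\<And>\<alpha>. \<alpha> < \<delta> \<Longrightarrow> \<exists>\<gamma>. \<alpha> \<le> \<gamma> \<and> \<gamma> < \<delta> \<and> forces_mem \<gamma> C p"
  shows "\<exists>q\<in>sacks W. q \<subseteq> p \<and> forces_mem \<delta> C q"
proof -
  have "forces_cofinal_below \<delta> C p"
    unfolding forces_cofinal_below_def forces_ball_def
  proof (intro ballI forces_bexI)
    fix \<alpha> q assume "\<alpha> \<in> {..<\<delta>}" and q: "q \<in> sacks W" "q \<subseteq> p"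
    then obtain \<gamma> where \<gamma>: "\<alpha> \<le> \<gamma>" "\<gamma> < \<delta>" "forces_mem \<gamma> C p" using cof by blast
    then have "\<gamma> \<in> {\<alpha>..<\<delta>} \<and> forces_mem \<gamma> C q" using forces_mem_mono[OF _ q(2)] by simp
    then show "\<exists>r\<in>sacks W. r \<subseteq> q \<and> (\<exists>\<gamma>\<in>{\<alpha>..<\<delta>}. forces_mem \<gamma> C r)"
      using q(1) by blast
  qed
  moreover have "forces_imp (forces_cofinal_below \<delta> C) (forces_mem \<delta> C) p"
    using C(1) \<delta> unfolding forces_club_def forces_and_def forces_ball_def by blast
  ultimately have "\<not> forces_not (forces_mem \<delta> C) p"
    using C(2) forces_notD unfolding forces_imp_def forces_and_def by blast
  then show ?thesis unfolding forces_not_def sacks_le_def by blast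
qed

text \<open>
  Decide the statements \<open>\<epsilon> \<in> x\<close> one after the other along a descending sequence of length \<open>\<beta>\<close>.
\<close>

lemma decide_below:
  fixes x :: "('a, 'a node set) name"
  assumes p: "p \<in> sacks W"
  shows "\<exists>q\<in>sacks W. q \<subseteq> p \<and> (\<forall>\<epsilon><\<beta>. forces_mem \<epsilon> x q \<or> forces_not (forces_mem \<epsilon> x) q)"
proof -
  let ?ok = "\<lambda>\<epsilon> q r. r \<in> sacks W \<and> r \<subseteq> q \<and>
      (forces_mem \<epsilon> x r \<or> forces_not (forces_mem \<epsilon> x) r)"
  define st where "st \<epsilon> q = (SOME r. ?ok \<epsilon> q r)" for \<epsilon> q
  have st: "?ok \<epsilon> q (st \<epsilon> q)" if "q \<in> sacks W" for \<epsilon> q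
    unfolding st_def
  proof (rule someI_ex)
    show "\<exists>r. ?ok \<epsilon> q r" using that unfolding forces_not_def sacks_le_def by blast
  qed
  have d: "descend st p \<gamma> \<in> sacks W" for \<gamma> by (rule descend_sacks[OF p]) (use st in blast)
  show ?thesis
  proof (intro bexI[OF _ d] conjI allI impI)
    show "descend st p \<beta> \<subseteq> p" by (rule descend_subset)
    fix \<epsilon> assume "\<epsilon> < \<beta>"
    then have "descend st p \<beta> \<subseteq> st \<epsilon> (descend st p \<epsilon>)" by (rule descend_step)
    then show "forces_mem \<epsilon> x (descend st p \<beta>) \<or> forces_not (forces_mem \<epsilon> x) (descend st p \<beta>)"
      using st[OF d[of \<epsilon>], of \<epsilon>] decided_mono by metis
  qed
qed

text \<open>
  What a single step of the construction of \<open>guessing_condition\<close> achieves at an ordinal \<open>\<beta>\<close>: the condition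
  \<open>p\<close> is strengthened to \<open>q\<close> above its node \<open>\<eta>\<close>, with \<open>\<nu>\<close> an initial segment of the stem of \<open>q\<close>.
\<close>

definition decides_step ::
  "('a, 'a node set) name \<Rightarrow> ('a, 'a node set) name \<Rightarrow> 'a \<Rightarrow> 'a node set \<Rightarrow> 'a node \<Rightarrow>
    'a node set \<Rightarrow> 'a node \<Rightarrow> 'a \<Rightarrow> bool" where
  "decides_step x C \<beta> p \<eta> q \<nu> \<gamma> \<longleftrightarrow>
    q \<in> sacks W \<and> q \<subseteq> p \<and> \<nu> \<in> nodes \<and> \<eta> \<subseteq>\<^sub>m \<nu> \<and> \<beta> \<le> len \<nu> \<and>
    (\<forall>u\<in>q. u \<subseteq>\<^sub>m \<nu> \<or> \<nu> \<subseteq>\<^sub>m u) \<and>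
    (\<forall>\<epsilon><\<beta>. forces_mem \<epsilon> x q \<or> forces_not (forces_mem \<epsilon> x) q) \<and> \<beta> \<le> \<gamma> \<and> forces_mem \<gamma> C q"

lemma ex_decides_step:
  assumes p: "p \<in> sacks W" and C: "forces_club C p" and \<eta>: "\<eta> \<in> p"
  shows "\<exists>q \<nu> \<gamma>. decides_step x C \<beta> p \<eta> q \<nu> \<gamma>"
proof -
  obtain \<nu> where \<nu>: "\<nu> \<in> p" "\<eta> \<subseteq>\<^sub>m \<nu>" "\<beta> \<le> len \<nu>" by (rule sacks_extend_node[OF p \<eta>])
  let ?q1 = "subtree p \<nu>"
  have q1: "?q1 \<in> sacks W" "?q1 \<subseteq> p" by (rule subtree_sacks[OF p \<nu>(1)]) (auto simp: subtree_def)
  obtain q2 where q2: "q2 \<in> sacks W" "q2 \<subseteq> ?q1"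
    "\<forall>\<epsilon><\<beta>. forces_mem \<epsilon> x q2 \<or> forces_not (forces_mem \<epsilon> x) q2" using decide_below[OF q1(1)] by blast
  have "forces_club C q2" using forces_club_mono[OF C] q1 q2 by blast
  then obtain q \<gamma> where q: "q \<in> sacks W" "q \<subseteq> q2" "\<beta> \<le> \<gamma>" "forces_mem \<gamma> C q"
    using forces_club_unbounded q2(1) by blast
  have "\<forall>\<epsilon><\<beta>. forces_mem \<epsilon> x q \<or> forces_not (forces_mem \<epsilon> x) q"
    using q2(3) decided_mono[OF _ q(2)] by metis
  moreover have "\<forall>u\<in>q. u \<subseteq>\<^sub>m \<nu> \<or> \<nu> \<subseteq>\<^sub>m u" using q(2) q2(2) by (auto simp: subtree_def)
  moreover have "\<nu> \<in> nodes" using sacksD(5)[OF p \<nu>(1)] .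
  ultimately have "decides_step x C \<beta> p \<eta> q \<nu> \<gamma>"
    unfolding decides_step_def using q q1(2) q2(2) \<nu> by auto
  then show ?thesis by blast
qed

section \<open>The tree of conditions along an approaching sequence\<close>

text \<open>
  The tree of conditions. Its levels are the elements of a set \<open>c\<close> of ordinals, in the end the set
  \<open>D\<close> witnessing the approachability of \<open>\<delta>\<close>, and the ranks of the levels in the cofinal set \<open>H \<subseteq> \<sigma>\<close> say which
  restriction of a branch \<open>f \<in> \<^bsup>\<sigma>\<^esup>2\<close> may be used at a level. The construction has to be defined for
  arbitrary \<open>c\<close>, without knowing \<open>\<delta>\<close>, since its heights must be captured by a function \<open>g\<close> on
  sets under which \<open>\<delta>\<close> is then chosen to be closed.
\<close>

lemma guessing_condition:
  fixes F :: "'a node \<Rightarrow> 'a node" and \<sigma> :: 'a and S :: "'a set" and x C :: "('a, 'a node set) name"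
  defines "FF \<equiv> Func {..<\<sigma>} (UNIV :: bool set)"
  assumes Z: "small (seqs_below {..<\<sigma>} :: 'a node set) \<kappa>"
    and lim\<sigma>: "is_limit \<sigma>"
    and F: "\<And>t y. (\<And>s. t s \<in> nodes) \<Longrightarrow> (\<And>s. y s \<in> nodes) \<Longrightarrow> inj_on (glue \<sigma> t) FF \<Longrightarrow>
       \<exists>f\<in>FF. F (glue \<sigma> t f) = glue \<sigma> y f"
    and H: "cofinal_in {..<\<sigma>} H" "has_otp H (cf \<sigma>)"
    and S: "S \<subseteq> {\<alpha>. cf \<alpha> = cf \<sigma>}" "stationary S" "S \<in> approach_ideal"
    and p0: "p0 \<in> sacks W" and C: "forces_club C p0"
  obtains q \<delta> E where "q \<in> sacks W" "q \<subseteq> p0" "\<delta> \<in> S" "dom E = {..<\<delta>}"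
    "\<And>u. u \<in> q \<Longrightarrow> u \<subseteq>\<^sub>m E \<or> E \<subseteq>\<^sub>m u" "forces_mem \<delta> C q"
    "\<And>\<epsilon>. \<epsilon> < \<delta> \<Longrightarrow> if F E \<epsilon> = Some True then forces_mem \<epsilon> x q else forces_not (forces_mem \<epsilon> x) q"
proof -
  let ?Z = "seqs_below {..<\<sigma>} :: 'a node set"
  have "\<exists>A. p \<in> sacks W \<longrightarrow> (\<forall>s\<in>?Z. A s \<in> p) \<and>
      (\<forall>s\<in>?Z. \<forall>s'\<in>?Z. s \<noteq> s' \<longrightarrow> (\<exists>\<xi>\<in>dom (A s) \<inter> dom (A s'). A s \<xi> \<noteq> A s' \<xi>))"
    for p :: "'a node set"
  proof (cases "p \<in> sacks W")
    case True
    have "|?Z| \<le>o |UNIV :: 'a set|" using Z by (rule ordLess_imp_ordLeq)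
    then show ?thesis using sacks_antichain[OF True, of ?Z] by metis
  qed blast
  then obtain A where A: "\<And>p s. p \<in> sacks W \<Longrightarrow> s \<in> ?Z \<Longrightarrow> A p s \<in> p"
    "\<And>p s s'. p \<in> sacks W \<Longrightarrow> s \<in> ?Z \<Longrightarrow> s' \<in> ?Z \<Longrightarrow> s \<noteq> s' \<Longrightarrow>
       \<exists>\<xi>\<in>dom (A p s) \<inter> dom (A p s'). A p s \<xi> \<noteq> A p s' \<xi>"
    by metis
  have "\<exists>q \<nu> \<gamma>. decides_step x C \<beta> p (A p s) q \<nu> \<gamma>"
    if "p \<in> sacks W" "p \<subseteq> p0" "s \<in> ?Z" for \<beta> s p
    using ex_decides_step[OF that(1) forces_club_mono[OF C that(2)] A(1)[OF that(1,3)]] .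
  then have ex: "\<exists>z. decides_step x C \<beta> p (A p s) (fst z) (fst (snd z)) (snd (snd z))"
    if "p \<in> sacks W" "p \<subseteq> p0" "s \<in> ?Z" for \<beta> s p
    using that by (metis fst_conv snd_conv)
  define z where "z \<beta> s p =
    (SOME z. decides_step x C \<beta> p (A p s) (fst z) (fst (snd z)) (snd (snd z)))" for \<beta> s p
  define Q where "Q \<beta> s p = fst (z \<beta> s p)" for \<beta> s p
  define N where "N \<beta> s p = fst (snd (z \<beta> s p))" for \<beta> s p
  define G where "G \<beta> s p = snd (snd (z \<beta> s p))" for \<beta> s p
  have step: "decides_step x C \<beta> p (A p s) (Q \<beta> s p) (N \<beta> s p) (G \<beta> s p)"
    if "p \<in> sacks W" "p \<subseteq> p0" "s \<in> ?Z" for \<beta> s p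
    unfolding Q_def N_def G_def z_def by (rule someI_ex[OF ex[OF that]])
  \<comment> \<open>\<open>M f c \<beta>\<close> is the condition reached below level \<open>\<beta>\<close> on the branch \<open>f\<close> when the levels are the elements
    of \<open>c\<close>. At level \<open>\<gamma>\<close> the restriction of \<open>f\<close> to the rank of \<open>\<gamma>\<close> selects a member of the antichain
    \<open>A\<close> of the current condition, and the stem is made to extend it.\<close>
  define T where "T f c \<gamma> p = (if \<gamma> \<in> c then Q \<gamma> (code f (rank_into H c \<gamma>)) p else p)" for f c \<gamma> p
  define M where "M f c \<beta> = descend (T f c) p0 \<beta>" for f c \<beta>
  define val where "val f c \<gamma> = max (len (N \<gamma> (code f (rank_into H c \<gamma>)) (M f c \<gamma>)))
    (G \<gamma> (code f (rank_into H c \<gamma>)) (M f c \<gamma>))" for f c \<gamma>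
  \<comment> \<open>A bound for all heights occurring along \<open>c\<close>; it exists for the bounded initial segments of the set
    \<open>D\<close> below.\<close>
  define g where "g c = (SOME b. \<forall>f. \<forall>\<gamma>\<in>c. val f c \<gamma> < b)" for c
  \<comment> \<open>This makes approachability applicable: the construction below \<open>\<beta>\<close> is determined by
    \<open>c \<inter> \<beta>\<close> and by the restrictions of \<open>f\<close> used there.\<close>
  have M_cong: "M f c \<beta> = M f' c' \<beta>"
    if "\<And>\<gamma>. \<gamma> < \<beta> \<Longrightarrow> \<gamma> \<in> c \<longleftrightarrow> \<gamma> \<in> c'"
      and "\<And>\<gamma>. \<gamma> < \<beta> \<Longrightarrow> \<gamma> \<in> c \<Longrightarrow> code f (rank_into H c \<gamma>) = code f' (rank_into H c \<gamma>)" for f f' c c' \<beta>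
    unfolding M_def
  proof (rule descend_cong)
    fix \<gamma> assume \<gamma>: "\<gamma> < \<beta>"
    have "rank_into H c \<gamma> = rank_into H c' \<gamma>"
      by (rule rank_into_cong) (use that(1) \<gamma> in \<open>blast intro: less_trans\<close>)
    then show "T f c \<gamma> = T f' c' \<gamma>"
      using that(1)[OF \<gamma>] that(2)[OF \<gamma>] by (intro ext) (simp add: T_def)
  qed

  obtain a where "S \<in> approach_ideal_of a" using S(3) unfolding approach_ideal_def by blast
  then obtain Cl where Cl: "club_in UNIV Cl" and a: "\<forall>\<delta>\<in>S \<inter> Cl.
      \<exists>D. club_in {..<\<delta>} D \<and> has_otp D (cf \<delta>) \<and> {D \<inter> {..<\<beta>} |\<beta>. \<beta> < \<delta>} \<subseteq> {a \<alpha> |\<alpha>. \<alpha> < \<delta>}"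
    unfolding approach_ideal_of_def by auto
  obtain \<delta> where \<delta>: "\<delta> \<in> S \<inter> Cl" "is_limit \<delta>" "\<And>\<alpha>. \<alpha> < \<delta> \<Longrightarrow> g (a \<alpha>) < \<delta>"
    using stationary_club_closure_point[OF S(2) Cl, of "\<lambda>\<alpha>. g (a \<alpha>)"] by metis
  obtain D where D: "club_in {..<\<delta>} D" "has_otp D (cf \<delta>)"
    "{D \<inter> {..<\<beta>} |\<beta>. \<beta> < \<delta>} \<subseteq> {a \<alpha> |\<alpha>. \<alpha> < \<delta>}" using bspec[OF a \<delta>(1)] by blast
  have D\<delta>: "D \<subseteq> {..<\<delta>}" and Dcof: "\<And>\<alpha>. \<alpha> < \<delta> \<Longrightarrow> \<exists>\<gamma>\<in>D. \<alpha> \<le> \<gamma>"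
    using D(1) unfolding club_in_def cofinal_in_def by auto
  have Dcof': "\<exists>\<gamma>\<in>D. \<alpha> < \<gamma>" if "\<alpha> < \<delta>" for \<alpha>
    using Dcof[OF suc_less_limit[OF \<delta>(2) that]] less_suc_iff[of \<alpha> \<alpha>] by (meson less_le_trans order.refl)
  define r where "r = rank_into H D"
  have "cf \<delta> = cf \<sigma>" using \<delta>(1) S(1) by blast
  then have "Restr ord_le D =o Restr ord_le H"
    using D(2) H(2) unfolding has_otp_def by (metis ordIso_symmetric ordIso_transitive)
  then obtain \<phi> where \<phi>: "bij_betw \<phi> D H" "\<And>\<beta> \<gamma>. \<beta> \<in> D \<Longrightarrow> \<gamma> \<in> D \<Longrightarrow> \<gamma> < \<beta> \<Longrightarrow> \<phi> \<gamma> < \<phi> \<beta>"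
    by (rule ord_le_Restr_iso) blast
  have r\<phi>: "r \<gamma> = \<phi> \<gamma>" if "\<gamma> \<in> D" for \<gamma>
    unfolding r_def by (rule rank_into_eq_iso[OF \<phi> that])
  have r\<sigma>: "r \<gamma> < \<sigma>" if "\<gamma> \<in> D" for \<gamma>
    using that r\<phi> \<phi>(1) H(1) unfolding cofinal_in_def bij_betw_def by auto
  have rmono: "r \<gamma> < r \<beta>" if "\<beta> \<in> D" "\<gamma> \<in> D" "\<gamma> < \<beta>" for \<beta> \<gamma>
    using that r\<phi> \<phi>(2) by simp
  have rinj: "\<beta> = \<gamma>" if "\<beta> \<in> D" "\<gamma> \<in> D" "r \<beta> = r \<gamma>" for \<beta> \<gamma>
    using rmono[of \<beta> \<gamma>] rmono[of \<gamma> \<beta>] that by (cases \<beta> \<gamma> rule: linorder_cases) auto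
  have rcof: "\<exists>\<gamma>\<in>D. \<xi> < r \<gamma>" if \<xi>: "\<xi> < \<sigma>" for \<xi>
  proof -
    obtain h where "h \<in> H" "suc \<xi> \<le> h"
      using H(1) suc_less_limit[OF lim\<sigma> \<xi>] unfolding cofinal_in_def by blast
    moreover then obtain \<gamma> where "\<gamma> \<in> D" "h = \<phi> \<gamma>" using \<phi>(1) unfolding bij_betw_def by blast
    ultimately show ?thesis using r\<phi> less_suc_iff[of \<xi> \<xi>] by (metis less_le_trans order.refl)
  qed
  have codeZ: "code f (r \<gamma>) \<in> ?Z" if "\<gamma> \<in> D" for f \<gamma>
    using r\<sigma>[OF that] by (rule code_seqs)

  have TD: "T f D \<gamma> q \<in> sacks W \<and> T f D \<gamma> q \<subseteq> q" if "q \<in> sacks W" "q \<subseteq> p0" for f \<gamma> q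
    using step[OF that codeZ] that(1) by (auto simp: T_def r_def decides_step_def)
  have MD: "M f D \<beta> \<in> sacks W" "M f D \<beta> \<subseteq> p0" for f \<beta>
    unfolding M_def by (rule descend_sacks[OF p0 TD], assumption+) (rule descend_subset)
  define Qf where "Qf f \<gamma> = Q \<gamma> (code f (r \<gamma>)) (M f D \<gamma>)" for f \<gamma>
  define Nf where "Nf f \<gamma> = N \<gamma> (code f (r \<gamma>)) (M f D \<gamma>)" for f \<gamma>
  define Gf where "Gf f \<gamma> = G \<gamma> (code f (r \<gamma>)) (M f D \<gamma>)" for f \<gamma>
  have f_step: "Qf f \<gamma> \<in> sacks W" "Nf f \<gamma> \<in> nodes" "A (M f D \<gamma>) (code f (r \<gamma>)) \<subseteq>\<^sub>m Nf f \<gamma>"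
    "\<gamma> \<le> len (Nf f \<gamma>)" "\<forall>u\<in>Qf f \<gamma>. u \<subseteq>\<^sub>m Nf f \<gamma> \<or> Nf f \<gamma> \<subseteq>\<^sub>m u"
    "\<forall>\<epsilon><\<gamma>. forces_mem \<epsilon> x (Qf f \<gamma>) \<or> forces_not (forces_mem \<epsilon> x) (Qf f \<gamma>)"
    "\<gamma> \<le> Gf f \<gamma>" "forces_mem (Gf f \<gamma>) C (Qf f \<gamma>)" if "\<gamma> \<in> D" for f \<gamma>
    using step[OF MD codeZ[OF that], of \<gamma> f] unfolding Qf_def Nf_def Gf_def decides_step_def by blast+
  have MQ: "M f D \<delta> \<subseteq> Qf f \<gamma>" if "\<gamma> \<in> D" for f \<gamma>
    using descend_step[of \<gamma> \<delta> "T f D" p0] that D\<delta> by (auto simp: M_def Qf_def T_def r_def)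

  \<comment> \<open>Extending a restriction of \<open>f\<close> by the value \<open>False\<close> gives a branch with the same conditions up to the
    corresponding level. So conditions and heights at a level are functions of the restriction, of
    which there are fewer than \<open>\<kappa>\<close>.\<close>
  define ext where "ext s = (\<lambda>\<xi>. s \<xi> = Some True)" for s :: "'a node"
  have code_ext: "code (ext (code f \<nu>)) \<nu> = code f \<nu>" for f \<nu>
    by (auto simp: code_def ext_def fun_eq_iff)
  have M_dep: "M f D \<beta> = M f' D \<beta>" if "\<And>\<gamma>. \<gamma> \<in> D \<Longrightarrow> \<gamma> < \<beta> \<Longrightarrow> code f (r \<gamma>) = code f' (r \<gamma>)" for f f' \<beta>
    by (rule M_cong) (use that in \<open>auto simp: r_def\<close>)
  have M_ext: "M (ext (code f (r \<gamma>))) D \<gamma> = M f D \<gamma>" if "\<gamma> \<in> D" for f \<gamma>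
  proof (rule M_dep)
    fix \<beta> assume "\<beta> \<in> D" "\<beta> < \<gamma>"
    then have "r \<beta> < r \<gamma>" using rmono that by blast
    then show "code (ext (code f (r \<gamma>))) (r \<beta>) = code f (r \<beta>)"
      using code_ext[of f "r \<gamma>"] unfolding code_eq_iff by (meson less_trans)
  qed
  have val\<delta>: "val f D \<gamma> < \<delta>" if \<gamma>: "\<gamma> \<in> D" for f \<gamma>
  proof -
    let ?c = "D \<inter> {..<suc \<gamma>}"
    have val_eq: "val f ?c \<zeta> = val f D \<zeta>" if "\<zeta> < suc \<gamma>" for f \<zeta>
    proof -
      have "rank_into H ?c \<xi> = rank_into H D \<xi>" if "\<xi> \<le> \<zeta>" for \<xi>
        by (rule rank_into_cong) (use \<open>\<zeta> < suc \<gamma>\<close> that in auto)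
      moreover have "M f ?c \<zeta> = M f D \<zeta>"
        by (rule M_cong) (use \<open>\<zeta> < suc \<gamma>\<close> in auto)
      ultimately show ?thesis by (simp add: val_def)
    qed
    have "\<exists>b. \<forall>s\<in>?Z. val (ext s) D \<zeta> < b" for \<zeta> by (rule image_bounded[OF Z])
    then obtain b where b: "\<And>\<zeta> s. s \<in> ?Z \<Longrightarrow> val (ext s) D \<zeta> < b \<zeta>" by metis
    obtain b' where b': "\<And>\<zeta>. \<zeta> < suc \<gamma> \<Longrightarrow> b \<zeta> < b'"
      using image_bounded[OF small_lessThan, of "suc \<gamma>" b] by blast
    have val_ext: "val f D \<zeta> = val (ext (code f (r \<zeta>))) D \<zeta>" if "\<zeta> \<in> D" for f \<zeta>
      using M_ext[OF that, of f] code_ext[of f "r \<zeta>"] by (simp add: val_def r_def)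
    have "\<forall>f. \<forall>\<zeta>\<in>?c. val f ?c \<zeta> < b'"
    proof (intro allI ballI)
      fix f \<zeta> assume \<zeta>: "\<zeta> \<in> ?c"
      have "val f D \<zeta> < b \<zeta>" using b[OF codeZ[of \<zeta> f], of \<zeta>] val_ext[of \<zeta> f] \<zeta> by simp
      also have "\<dots> < b'" using b' \<zeta> by blast
      finally show "val f ?c \<zeta> < b'" using val_eq[of \<zeta> f] \<zeta> by simp
    qed
    then have "\<forall>f. \<forall>\<zeta>\<in>?c. val f ?c \<zeta> < g ?c" unfolding g_def by (rule someI)
    moreover have "\<gamma> \<in> ?c" using \<gamma> by simp
    ultimately have "val f ?c \<gamma> < g ?c" by blast
    then have "val f D \<gamma> < g ?c" using val_eq[of \<gamma> f] by simp
    moreover have "suc \<gamma> < \<delta>" using suc_less_limit[OF \<delta>(2)] D\<delta> \<gamma> by blast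
    then obtain \<alpha> where "\<alpha> < \<delta>" "?c = a \<alpha>" using D(3) by blast
    ultimately show ?thesis using \<delta>(3)[of \<alpha>] by simp
  qed
  have N\<delta>: "len (Nf f \<gamma>) < \<delta>" and G\<delta>: "Gf f \<gamma> < \<delta>" if "\<gamma> \<in> D" for f \<gamma>
    using val\<delta>[OF that, of f] by (auto simp: val_def Nf_def Gf_def r_def)

  \<comment> \<open>Level data depending on \<open>f\<close> through its restriction are reindexed by binary sequences; sequences whose
    length is not the rank of a level get the empty node, which does not affect unions.\<close>
  define lev where "lev s = (THE \<gamma>. \<gamma> \<in> D \<and> dom s = {..<r \<gamma>})" for s :: "'a node"
  have lev: "lev s = \<gamma>" if "\<gamma> \<in> D" "dom s = {..<r \<gamma>}" for s \<gamma>
    unfolding lev_def by (rule the_equality) (use that rinj in auto)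
  define at where "at h s = (if \<exists>\<gamma>\<in>D. dom s = {..<r \<gamma>} then h (ext s) (lev s) else Map.empty)"
    for h :: "('a \<Rightarrow> bool) \<Rightarrow> 'a \<Rightarrow> 'a node" and s
  have at_nodes: "at h s \<in> nodes" if "\<And>f \<gamma>. \<gamma> \<in> D \<Longrightarrow> h f \<gamma> \<in> nodes" for h s
    using that lev empty_node by (auto simp: at_def)
  have glue_at: "glue \<sigma> (at h) f = union_of (h f ` D) "
    if h: "\<And>f \<gamma>. \<gamma> \<in> D \<Longrightarrow> h (ext (code f (r \<gamma>))) \<gamma> = h f \<gamma>" and w: "\<And>\<gamma>. \<gamma> \<in> D \<Longrightarrow> h f \<gamma> \<subseteq>\<^sub>m w" for h f w
  proof -
    have at: "at h (code f (r \<gamma>)) = h f \<gamma>" if "\<gamma> \<in> D" for \<gamma>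
    proof -
      have "\<exists>\<gamma>'\<in>D. dom (code f (r \<gamma>)) = {..<r \<gamma>'}" using that dom_code by blast
      then show ?thesis
        unfolding at_def using lev[OF that dom_code, of f] h[OF that, of f] by simp
    qed
    have at': "at h (code f \<nu>) = Map.empty \<or> (\<exists>\<gamma>\<in>D. at h (code f \<nu>) = h f \<gamma>)" for \<nu>
    proof (cases "\<exists>\<gamma>\<in>D. \<nu> = r \<gamma>")
      case True
      then show ?thesis using at by blast
    next
      case False
      then show ?thesis by (auto simp: at_def dom_code)
    qed
    let ?A = "{at h (code f \<nu>) |\<nu>. \<nu> < \<sigma>}"
    have sub: "h f ` D \<subseteq> ?A"
    proof (rule image_subsetI)
      fix \<gamma> assume "\<gamma> \<in> D"
      then show "h f \<gamma> \<in> ?A" using at[of \<gamma>, symmetric] r\<sigma>[of \<gamma>] by blast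
    qed
    have sup: "?A \<subseteq> insert Map.empty (h f ` D)" using at' by fast
    show ?thesis
      unfolding glue_def
    proof (rule map_le_eqI)
      show "union_of ?A \<subseteq>\<^sub>m w"
      proof (rule union_of_map_le)
        fix n assume "n \<in> ?A"
        then have "n \<in> insert Map.empty (h f ` D)" using sup by (rule rev_subsetD)
        then show "n \<subseteq>\<^sub>m w" using w map_le_empty by blast
      qed
      show "union_of (h f ` D) \<subseteq>\<^sub>m w" by (rule union_of_map_le) (use w in auto)
      have "\<Union>(dom ` ?A) \<subseteq> \<Union>(dom ` insert Map.empty (h f ` D))"
        by (intro Union_mono image_mono sup)
      moreover have "\<Union>(dom ` (h f ` D)) \<subseteq> \<Union>(dom ` ?A)" by (intro Union_mono image_mono sub)
      ultimately show "dom (union_of ?A) = dom (union_of (h f ` D))"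
        unfolding dom_union_of by simp
    qed
  qed

  define q where "q f = M f D \<delta>" for f
  have q: "q f \<in> sacks W" "q f \<subseteq> p0" and qQ: "\<And>\<gamma>. \<gamma> \<in> D \<Longrightarrow> q f \<subseteq> Qf f \<gamma>" for f
    using MD MQ by (auto simp: q_def)
  \<comment> \<open>All stems on the branch \<open>f\<close> are initial segments of any node \<open>w f\<close> of length at least
    \<open>\<delta>\<close> in the limit condition, and this makes them pairwise comparable.\<close>
  have "\<exists>w. w \<in> q f \<and> \<delta> \<le> len w" for f
    using sacks_extend_node[OF q(1) tree_empty[OF sacksD(1)[OF q(1)]]] by metis
  then obtain w where w: "\<And>f. w f \<in> q f" "\<And>f. \<delta> \<le> len (w f)" by metis
  have wn: "w f \<in> nodes" for f using sacksD(5)[OF q(1) w(1)] .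
  have Nw: "Nf f \<gamma> \<subseteq>\<^sub>m w f" if "\<gamma> \<in> D" for f \<gamma>
  proof -
    have "w f \<subseteq>\<^sub>m Nf f \<gamma> \<or> Nf f \<gamma> \<subseteq>\<^sub>m w f" using f_step(5)[OF that] qQ[OF that] w(1) by blast
    then show ?thesis
      using map_le_iff_node[OF wn f_step(2)[OF that]] N\<delta>[OF that, of f] w(2)[of f] by (meson leD le_less_trans less_le_trans)
  qed
  define t where "t = at Nf"
  define Y where "Y f \<gamma> = code (\<lambda>\<epsilon>. forces_mem \<epsilon> x (Qf f \<gamma>)) \<gamma>" for f \<gamma>
  define y where "y = at Y"
  have t: "t s \<in> nodes" for s unfolding t_def by (rule at_nodes) (rule f_step(2))
  have y: "y s \<in> nodes" for s unfolding y_def by (rule at_nodes) (simp add: Y_def nodesI[OF dom_code])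
  have E: "glue \<sigma> t f = union_of (Nf f ` D)" for f
    unfolding t_def by (rule glue_at[OF _ Nw]) (simp add: Nf_def M_ext code_ext)
  have NE: "Nf f \<gamma> \<subseteq>\<^sub>m glue \<sigma> t f" if "\<gamma> \<in> D" for f \<gamma>
    unfolding E by (rule map_le_union_of) (use map_le_total[OF Nw Nw] f_step(2) that in auto)
  have dom_union: "(\<Union>\<gamma>\<in>D. dom (h \<gamma>)) = {..<\<delta>}"
    if "\<And>\<gamma>. \<gamma> \<in> D \<Longrightarrow> h \<gamma> \<in> nodes \<and> \<gamma> \<le> len (h \<gamma>) \<and> len (h \<gamma>) < \<delta>" for h :: "'a \<Rightarrow> 'a node"
  proof -
    have "(\<Union>\<gamma>\<in>D. dom (h \<gamma>)) = (\<Union>\<gamma>\<in>D. {..<len (h \<gamma>)})"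
      using that by (intro SUP_cong refl dom_node) blast
    also have "\<dots> = {..<\<delta>}"
    proof (intro equalityI subsetI)
      fix \<xi> assume "\<xi> \<in> {..<\<delta>}"
      then obtain \<gamma> where "\<gamma> \<in> D" "\<xi> < \<gamma>" using Dcof' by blast
      then show "\<xi> \<in> (\<Union>\<gamma>\<in>D. {..<len (h \<gamma>)})" using that by (auto intro: less_le_trans)
    qed (use that in \<open>auto intro: less_trans\<close>)
    finally show ?thesis .
  qed
  have domE: "dom (glue \<sigma> t f) = {..<\<delta>}" for f
    unfolding E dom_union_of using dom_union[of "Nf f"] f_step(2,4) N\<delta> by simp
  have decided: "forces_mem \<epsilon> x (Qf f \<gamma>) \<longleftrightarrow> forces_mem \<epsilon> x (q f)"
    "\<not> forces_mem \<epsilon> x (q f) \<Longrightarrow> forces_not (forces_mem \<epsilon> x) (q f)"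
    if "\<gamma> \<in> D" "\<epsilon> < \<gamma>" for f \<gamma> \<epsilon>
  proof -
    have "forces_mem \<epsilon> x (Qf f \<gamma>) \<or> forces_not (forces_mem \<epsilon> x) (Qf f \<gamma>)" using f_step(6) that by blast
    then have *: "forces_mem \<epsilon> x (Qf f \<gamma>) \<and> forces_mem \<epsilon> x (q f) \<or>
        \<not> forces_mem \<epsilon> x (q f) \<and> forces_not (forces_mem \<epsilon> x) (q f)"
      using forces_mem_mono[OF _ qQ[OF that(1)]] forces_not_mono[OF _ qQ[OF that(1)]]
        forces_notD[OF _ q(1)] by metis
    then show "forces_mem \<epsilon> x (Qf f \<gamma>) \<longleftrightarrow> forces_mem \<epsilon> x (q f)"
      using forces_mem_mono[OF _ qQ[OF that(1)]] by metis
    show "\<not> forces_mem \<epsilon> x (q f) \<Longrightarrow> forces_not (forces_mem \<epsilon> x) (q f)" using * by metis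
  qed
  have YV: "Y f \<gamma> \<subseteq>\<^sub>m code (\<lambda>\<epsilon>. forces_mem \<epsilon> x (q f)) \<delta>" if "\<gamma> \<in> D" for f \<gamma>
    unfolding map_le_def Y_def dom_code using decided(1)[OF that] D\<delta> that
    by (auto simp: code_def intro: less_trans)
  have X: "glue \<sigma> y f = code (\<lambda>\<epsilon>. forces_mem \<epsilon> x (q f)) \<delta>" for f
  proof -
    have "glue \<sigma> y f = union_of (Y f ` D)"
      unfolding y_def by (rule glue_at[OF _ YV]) (simp add: Y_def Qf_def M_ext code_ext)
    moreover have "union_of (Y f ` D) \<subseteq>\<^sub>m code (\<lambda>\<epsilon>. forces_mem \<epsilon> x (q f)) \<delta>"
      by (rule union_of_map_le) (use YV in auto)
    moreover have "dom (union_of (Y f ` D)) = {..<\<delta>}"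
      unfolding dom_union_of using dom_union[of "Y f"] D\<delta>
      by (auto simp: Y_def nodesI[OF dom_code] len_eqI[OF dom_code])
    ultimately show ?thesis using map_le_eqI[OF _ map_le_refl] dom_code by metis
  qed
  have "inj_on (glue \<sigma> t) FF"
  proof (rule inj_onI, rule ccontr)
    fix f f' assume f: "f \<in> FF" "f' \<in> FF" and eq: "glue \<sigma> t f = glue \<sigma> t f'" and "f \<noteq> f'"
    then obtain \<xi> where \<xi>: "f \<xi> \<noteq> f' \<xi>" by blast
    then have "\<xi> < \<sigma>" using f unfolding FF_def Func_def by auto
    then obtain \<gamma>0 where "\<gamma>0 \<in> D" "\<xi> < r \<gamma>0" using rcof by blast
    then have ex: "\<gamma>0 \<in> D \<and> code f (r \<gamma>0) \<noteq> code f' (r \<gamma>0)" using \<xi> by (auto simp: code_eq_iff)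
    \<comment> \<open>Up to the first level where the restrictions of \<open>f\<close> and \<open>f'\<close> differ, the conditions coincide; there
    different members of the same antichain are chosen.\<close>
    define \<gamma> where "\<gamma> = (LEAST \<gamma>. \<gamma> \<in> D \<and> code f (r \<gamma>) \<noteq> code f' (r \<gamma>))"
    have \<gamma>: "\<gamma> \<in> D" "code f (r \<gamma>) \<noteq> code f' (r \<gamma>)"
      unfolding \<gamma>_def using LeastI[of "\<lambda>\<gamma>. \<gamma> \<in> D \<and> code f (r \<gamma>) \<noteq> code f' (r \<gamma>)", OF ex] by blast+
    have Meq: "M f D \<gamma> = M f' D \<gamma>"
      by (rule M_dep) (use not_less_Least in \<open>auto simp: \<gamma>_def\<close>)
    obtain \<zeta> where \<zeta>: "\<zeta> \<in> dom (A (M f D \<gamma>) (code f (r \<gamma>)))" "\<zeta> \<in> dom (A (M f D \<gamma>) (code f' (r \<gamma>)))"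
      "A (M f D \<gamma>) (code f (r \<gamma>)) \<zeta> \<noteq> A (M f D \<gamma>) (code f' (r \<gamma>)) \<zeta>"
      using A(2)[OF MD(1)[of f \<gamma>] codeZ[OF \<gamma>(1)] codeZ[OF \<gamma>(1)] \<gamma>(2)] by blast
    have le: "A (M f'' D \<gamma>) (code f'' (r \<gamma>)) \<subseteq>\<^sub>m glue \<sigma> t f''" for f''
      using f_step(3)[OF \<gamma>(1)] NE[OF \<gamma>(1)] by (rule map_le_trans)
    show False using le[of f] le[of f'] eq \<zeta> Meq unfolding map_le_def by metis
  qed
  then have "\<exists>f\<in>FF. F (glue \<sigma> t f) = glue \<sigma> y f" by (rule F[OF t y])
  then obtain f where f: "F (glue \<sigma> t f) = glue \<sigma> y f" by blast
  have "\<exists>\<gamma>. \<alpha> \<le> \<gamma> \<and> \<gamma> < \<delta> \<and> forces_mem \<gamma> C (q f)" if \<alpha>: "\<alpha> < \<delta>" for \<alpha>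
  proof -
    obtain \<gamma> where \<gamma>: "\<gamma> \<in> D" "\<alpha> \<le> \<gamma>" using Dcof[OF \<alpha>] by blast
    have "forces_mem (Gf f \<gamma>) C (q f)" using forces_mem_mono[OF f_step(8) qQ] \<gamma>(1) by blast
    then show ?thesis using f_step(7)[OF \<gamma>(1), of f] G\<delta>[OF \<gamma>(1), of f] \<gamma>(2) by (meson order_trans)
  qed
  then obtain q' where q': "q' \<in> sacks W" "q' \<subseteq> q f" "forces_mem \<delta> C q'"
    using forces_club_closed[OF forces_club_mono[OF C q(2)] q(1) \<delta>(2)] by blast
  show thesis
  proof (rule that[OF q'(1) _ _ domE _ q'(3)])
    show "q' \<subseteq> p0" using q'(2) q(2) by blast
    show "\<delta> \<in> S" using \<delta>(1) by blast
    show "u \<subseteq>\<^sub>m glue \<sigma> t f \<or> glue \<sigma> t f \<subseteq>\<^sub>m u" if "u \<in> q'" for u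
    proof (cases "\<forall>\<gamma>\<in>D. Nf f \<gamma> \<subseteq>\<^sub>m u")
      case True
      then show ?thesis unfolding E by (intro disjI2 union_of_map_le) auto
    next
      case False
      then obtain \<gamma> where \<gamma>: "\<gamma> \<in> D" "\<not> Nf f \<gamma> \<subseteq>\<^sub>m u" by blast
      then have "u \<subseteq>\<^sub>m Nf f \<gamma>" using f_step(5)[OF \<gamma>(1)] qQ[OF \<gamma>(1)] q'(2) that by blast
      then show ?thesis using NE[OF \<gamma>(1), of f] map_le_trans by blast
    qed
    show "if F (glue \<sigma> t f) \<epsilon> = Some True then forces_mem \<epsilon> x q' else forces_not (forces_mem \<epsilon> x) q'"
      if "\<epsilon> < \<delta>" for \<epsilon>
    proof -
      obtain \<gamma> where \<gamma>: "\<gamma> \<in> D" "\<epsilon> < \<gamma>" using Dcof' \<open>\<epsilon> < \<delta>\<close> by blast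
      have "F (glue \<sigma> t f) \<epsilon> = Some (forces_mem \<epsilon> x (q f))"
        unfolding f X using that by (simp add: code_def)
      then show ?thesis
        using decided(2)[OF \<gamma>] forces_mem_mono[OF _ q'(2)] forces_not_mono[OF _ q'(2)] by auto
    qed
  qed
qed

section \<open>Forcing the diamond\<close>

text \<open>
  A density argument: it suffices to strengthen every condition forcing \<open>C\<close> to be a club to one that
  forces the guess to be right at some \<open>\<delta> \<in> S\<close> and \<open>\<delta>\<close> to be in \<open>C\<close>.
\<close>

lemma forces_diamondI:
  fixes S :: "'a set" and d :: "('a \<times> 'a, 'a node set) name"
  assumes "\<And>x C p. x \<subseteq> UNIV \<times> sacks W \<Longrightarrow> C \<subseteq> UNIV \<times> sacks W \<Longrightarrow> p \<in> sacks W \<Longrightarrow> forces_club C p \<Longrightarrow>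
      \<exists>q\<in>sacks W. q \<subseteq> p \<and> (\<exists>\<delta>\<in>S. forces_mem \<delta> C q \<and>
        (\<forall>\<epsilon><\<delta>. forces_iff (forces_mem (\<delta>, \<epsilon>) d) (forces_mem \<epsilon> x) q))"
    and d: "d \<subseteq> UNIV \<times> sacks W"
  shows "forced (forces_diamond S)"
proof -
  show ?thesis
    unfolding forced_def forces_diamond_def
  proof (intro ballI, rule forces_ex_nameI[OF d])
    fix p0 :: "'a node set"
    show "forces_all_names (\<lambda>x. forces_stationary S (\<lambda>\<delta>. forces_ball {..<\<delta>}
        (\<lambda>\<epsilon>. forces_iff (forces_mem (\<delta>, \<epsilon>) d) (forces_mem \<epsilon> x)))) p0"
      unfolding forces_all_names_def forces_stationary_def
    proof (intro allI impI forces_impI forces_bexI)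
      fix x C :: "('a, 'a node set) name" and p q
      assume xC: "x \<subseteq> UNIV \<times> sacks W" "C \<subseteq> UNIV \<times> sacks W"
        and "forces_club C p" and q: "q \<in> sacks W" "q \<subseteq> p"
      then have "forces_club C q" using forces_club_mono by blast
      then obtain r \<delta> where r: "r \<in> sacks W" "r \<subseteq> q" "\<delta> \<in> S" "forces_mem \<delta> C r"
        "\<forall>\<epsilon><\<delta>. forces_iff (forces_mem (\<delta>, \<epsilon>) d) (forces_mem \<epsilon> x) r"
        using assms(1)[OF xC q(1)] by blast
      show "\<exists>r\<in>sacks W. r \<subseteq> q \<and> (\<exists>\<delta>\<in>S. forces_and (forces_ball {..<\<delta>}
          (\<lambda>\<epsilon>. forces_iff (forces_mem (\<delta>, \<epsilon>) d) (forces_mem \<epsilon> x))) (forces_mem \<delta> C) r)"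
        using r by (intro bexI[OF _ r(1)] conjI bexI[OF _ r(3)])
          (simp_all add: forces_and_def forces_ball_def)
    qed
  qed
qed

lemma forces_iff_decided:
  assumes "\<And>q. q \<in> sacks W \<Longrightarrow> q \<subseteq> p \<Longrightarrow> \<phi> q \<longleftrightarrow> \<psi> q"
  shows "forces_iff \<phi> \<psi> p"
  unfolding forces_iff_def forces_and_def using assms by (auto intro!: forces_impI)

text \<open>
  The name for the sequence \<open>d\<^sub>\<delta> = F(\<eta> \<restriction> \<delta>)\<close>, where \<open>\<eta>\<close> is the generic branch: a condition decides
  \<open>\<eta> \<restriction> \<delta> = E\<close> when all its nodes are comparable with the node \<open>E\<close> of length \<open>\<delta>\<close>.
\<close>

definition guess_name :: "('a node \<Rightarrow> 'a node) \<Rightarrow> ('a \<times> 'a, 'a node set) name" where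
  "guess_name F = {((\<delta>, \<epsilon>), p). p \<in> sacks W \<and>
     (\<exists>E. dom E = {..<\<delta>} \<and> (\<forall>u\<in>p. u \<subseteq>\<^sub>m E \<or> E \<subseteq>\<^sub>m u) \<and> F E \<epsilon> = Some True)}"

text \<open>
  Two conditions with a common strengthening cannot decide \<open>\<eta> \<restriction> \<delta>\<close> differently, since the strengthening has
  nodes of length at least \<open>\<delta>\<close>.
\<close>

lemma forces_mem_guess_name:
  assumes p: "p \<in> sacks W" and E: "dom E = {..<\<delta>}" and pE: "\<And>u. u \<in> p \<Longrightarrow> u \<subseteq>\<^sub>m E \<or> E \<subseteq>\<^sub>m u"
  shows "forces_mem (\<delta>, \<epsilon>) (guess_name F) p \<longleftrightarrow> F E \<epsilon> = Some True"
proof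
  assume "F E \<epsilon> = Some True"
  then have "((\<delta>, \<epsilon>), p) \<in> guess_name F" using p E pE by (auto simp: guess_name_def)
  then show "forces_mem (\<delta>, \<epsilon>) (guess_name F) p"
    unfolding forces_mem_def sacks_le_def using p by blast
next
  assume "forces_mem (\<delta>, \<epsilon>) (guess_name F) p"
  then have "\<exists>r\<in>sacks W. r \<subseteq> p \<and> (\<exists>s\<in>sacks W. ((\<delta>, \<epsilon>), s) \<in> guess_name F \<and> r \<subseteq> s)"
    unfolding forces_mem_def sacks_le_def using p by simp
  then obtain r s where r: "r \<in> sacks W" "r \<subseteq> p" "r \<subseteq> s" "((\<delta>, \<epsilon>), s) \<in> guess_name F"
    by blast
  then obtain E' where E': "dom E' = {..<\<delta>}" "\<forall>u\<in>s. u \<subseteq>\<^sub>m E' \<or> E' \<subseteq>\<^sub>m u" "F E' \<epsilon> = Some True"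
    by (auto simp: guess_name_def)
  obtain w where w: "w \<in> r" "\<delta> \<le> len w"
    using sacks_extend_node[OF r(1) tree_empty[OF sacksD(1)[OF r(1)]]] by metis
  have wn: "w \<in> nodes" using sacksD(5)[OF r(1) w(1)] .
  have "e = trunc w \<delta>" if e: "dom e = {..<\<delta>}" "w \<subseteq>\<^sub>m e \<or> e \<subseteq>\<^sub>m w" for e
  proof -
    note n = nodesI[OF e(1)] len_eqI[OF e(1)]
    have "e \<subseteq>\<^sub>m w"
      using e(2) map_le_iff_node[OF wn n(1)] map_le_iff_node[OF n(1) wn] n(2) w(2) by force
    then show ?thesis using map_le_eq_trunc[OF _ n(1)] n(2) by metis
  qed
  then have "E = E'" using pE[of w] E E' r w(1) by (metis subsetD)
  then show "F E \<epsilon> = Some True" using E'(3) by simp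
qed

lemma sacks_forces_diamond:
  fixes \<sigma> :: 'a and S :: "'a set"
  assumes pow: "|seqs_below UNIV :: ('a \<rightharpoonup> 'a) set| \<le>o |UNIV :: 'a set|"
    and Z: "small (seqs_below {..<\<sigma>} :: 'a node set) \<kappa>"
    and FF: "|UNIV :: 'a set| \<le>o |Func {..<\<sigma>} (UNIV :: bool set)|"
    and lim: "is_limit \<sigma>"
    and H: "cofinal_in {..<\<sigma>} H" "has_otp H (cf \<sigma>)"
    and S: "S \<subseteq> {\<alpha>. cf \<alpha> = cf \<sigma>}" "stationary S" "S \<in> approach_ideal"
  shows "forced (forces_diamond S)"
proof -
  obtain F :: "'a node \<Rightarrow> 'a node" where
    F: "\<And>t y. (\<And>s. t s \<in> nodes) \<Longrightarrow> (\<And>s. y s \<in> nodes) \<Longrightarrow> inj_on (glue \<sigma> t) (Func {..<\<sigma>} UNIV) \<Longrightarrow>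
       \<exists>f\<in>Func {..<\<sigma>} UNIV. F (glue \<sigma> t f) = glue \<sigma> y f"
    using guessing_function[OF pow Z FF] by blast
  show ?thesis
  proof (rule forces_diamondI[where d = "guess_name F"])
    show "guess_name F \<subseteq> UNIV \<times> sacks W" by (auto simp: guess_name_def)
    fix x C :: "('a, 'a node set) name" and p
    assume p: "p \<in> sacks W" and C: "forces_club C p"
    obtain q \<delta> E where q: "q \<in> sacks W" "q \<subseteq> p" "\<delta> \<in> S" and E: "dom E = {..<\<delta>}"
      "\<And>u. u \<in> q \<Longrightarrow> u \<subseteq>\<^sub>m E \<or> E \<subseteq>\<^sub>m u" and qC: "forces_mem \<delta> C q"
      and qx: "\<And>\<epsilon>. \<epsilon> < \<delta> \<Longrightarrow> if F E \<epsilon> = Some True then forces_mem \<epsilon> x q else forces_not (forces_mem \<epsilon> x) q"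
      by (rule guessing_condition[OF Z lim F H S p C]) blast+
    have "forces_iff (forces_mem (\<delta>, \<epsilon>) (guess_name F)) (forces_mem \<epsilon> x) q" if "\<epsilon> < \<delta>" for \<epsilon>
    proof (rule forces_iff_decided)
      fix r assume r: "r \<in> sacks W" "r \<subseteq> q"
      have "forces_mem (\<delta>, \<epsilon>) (guess_name F) r \<longleftrightarrow> F E \<epsilon> = Some True"
        by (rule forces_mem_guess_name[OF r(1) E(1)]) (use E(2) r(2) in blast)
      also have "\<dots> \<longleftrightarrow> forces_mem \<epsilon> x r"
        using qx[OF that] forces_mem_mono[OF _ r(2)] forces_not_mono[OF _ r(2)] forces_notD[OF _ r(1)]
        by metis
      finally show "forces_mem (\<delta>, \<epsilon>) (guess_name F) r \<longleftrightarrow> forces_mem \<epsilon> x r" .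
    qed
    then show "\<exists>q\<in>sacks W. q \<subseteq> p \<and> (\<exists>\<delta>\<in>S. forces_mem \<delta> C q \<and>
        (\<forall>\<epsilon><\<delta>. forces_iff (forces_mem (\<delta>, \<epsilon>) (guess_name F)) (forces_mem \<epsilon> x) q))"
      using q qC by blast
  qed
qed

end

theorem theorem1p3:
  fixes W S :: "'a::wellorder set" and \<sigma> :: 'a
  assumes "Card_order (ord_le :: 'a rel)"
    and "cardSuc natLeq \<le>o (ord_le :: 'a rel)"
    and "|seqs_below UNIV :: ('a \<rightharpoonup> 'a) set| =o (ord_le :: 'a rel)"
    and "stationary W"
    and "Card_order (Restr ord_le {..<\<sigma>})"
    and "ctwo ^c Restr ord_le {..<\<sigma>} =o (ord_le :: 'a rel)"
    and "|seqs_below {..<\<sigma>} :: ('a \<rightharpoonup> bool) set| <o (ord_le :: 'a rel)"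
    and "S \<subseteq> {\<alpha>. cf \<alpha> = cf \<sigma>}"
    and "stationary S"
    and "S \<in> approach_ideal"
  shows "forcing.forced (sacks W) (forcing.forces_diamond (sacks W) sacks_le S)"
proof -
  have F: "Field (ord_le :: 'a rel) = UNIV" "Field (Restr ord_le {..<\<sigma>}) = {..<\<sigma>}"
    by (auto simp: ord_le_def Field_def)
  have iso: "|UNIV :: 'a set| =o (ord_le :: 'a rel)"
    using card_of_Field_ordIso[OF assms(1)] F by simp
  then have iso': "(ord_le :: 'a rel) =o |UNIV :: 'a set|" by (rule ordIso_symmetric)
  have pow: "|seqs_below UNIV :: ('a \<rightharpoonup> 'a) set| \<le>o |UNIV :: 'a set|"
    using ordIso_transitive[OF assms(3) iso'] by (rule ordIso_imp_ordLeq)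
  have FF: "|Func {..<\<sigma>} (UNIV :: bool set)| =o |UNIV :: 'a set|"
    using ordIso_transitive[OF assms(6) iso'] unfolding cexp_def ctwo_def F Field_card_of .
  interpret regular_cardinal "TYPE('a)" by (rule regular_cardinalI[OF assms(1,2) pow])
  interpret sacks_forcing "TYPE('a)" W by unfold_locales (rule assms(4))
  have "infinite (Func {..<\<sigma>} (UNIV :: bool set))"
    using card_of_ordIso_finite[OF FF] infinite_ordinals by blast
  moreover have "finite (Func A (UNIV :: bool set))" if "finite A" for A :: "'a set"
    by (rule finite_subset[OF _ finite_set_of_finite_funs[OF that finite_UNIV, of undefined]])
      (auto simp: Func_def)
  \<comment> \<open>\<open>\<sigma>\<close> is infinite because \<open>2\<^sup>\<sigma>\<close> is.\<close>
  ultimately have "is_limit \<sigma>" using infinite_Card_order_limit[OF assms(5)] by blast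
  moreover obtain H where "cofinal_in {..<\<sigma>} H" "has_otp H (cf \<sigma>)" by (rule cf_cofinal[OF assms(1)])
  moreover have "small (seqs_below {..<\<sigma>} :: 'a node set) TYPE('a)"
    using assms(7) iso' by (rule ordLess_ordIso_trans)
  ultimately show ?thesis
    using sacks_forces_diamond[OF pow _ ordIso_imp_ordLeq[OF ordIso_symmetric[OF FF]]] assms(8-10) by blast
qed

end
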